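(* Let $\{x_t\}$ be the iterates produced by the decision-dependent proximal stochastic gradient method with constant step size $\eta_t\equiv\eta$, $0<\eta\le1/(2L)$. Suppose there exist constants $\bar\Delta,\sigma>0$ such that for all $t\ge0$: (i) with $\bar\Delta_t=\|\bar x_t-\bar x_{t+1}\|$, $\mathbb{E}[\exp(\lambda\bar\Delta_t^2)\mid\mathcal{F}_t]\le\exp(\lambda\bar\Delta^2)$ for all $0\le\lambda\le\bar\Delta^{-2}$; (ii) $\mathbb{P}\{\|z_t\|\ge\tau\mid\mathcal{F}_t\}\le2\exp(-2\tau^2/\sigma^2)$ for all $\tau>0$. Then there exists an absolute constant $c>0$ such that for any specified $t\in\mathbb{N}$ and $\delta\in(0,1)$, the following estimate holds with probability at least $1-\delta$: $$\|x_t-\bar x_t\|^2\le\left(1-\tfrac{\bar\mu\eta}{2}\right)^t\|x_0-\bar x_0\|^2+\left(\frac{8\eta(c\sigma)^2}{\bar\mu}+4\left(\frac{\bar\Delta}{\bar\mu\eta}\right)^2\right)\log\left(\frac e\delta\right).$$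
   Context: Notation: $\mathbb{N}=\{0,1,2,\dots\}$; $\mathbb{R}^d$ carries the Euclidean inner product $\langle\cdot,\cdot\rangle$ and norm $\|\cdot\|$. An absolute constant is a numerical constant independent of all problem parameters (including dimension, $\mu,L,\gamma,\eta,\sigma,\bar\Delta,t,\delta$). Problem family. For each $t\in\mathbb{N}$ and $x\in\mathbb{R}^d$, $f_{t,x}\colon\mathbb{R}^d\to\mathbb{R}$ is $\mu$-strongly convex and $C^1$-smooth with $L$-Lipschitz gradient, for common constants $\mu,L>0$; $\nabla f_{t,x}(u)$ denotes the gradient of $f_{t,x}(\cdot)$ at $u$. For each $t$, $r_t\colon\mathbb{R}^d\to\mathbb{R}\cup\{\infty\}$ is proper, closed, convex. Set $$\gamma:=\sup_{t\in\mathbb{N},\,u,x,y\in\mathbb{R}^d,\,x\ne y}\frac{\|\nabla f_{t,x}(u)-\nabla f_{t,y}(u)\|}{\|x-y\|},$$ and assume $\gamma<\mu$. Set $\bar\mu:=\mu-\gamma>0$. The functions may be random (the problem may evolve stochastically), with these conditions holding for every outcome with deterministic $\mu,L,\gamma$. Equilibria. For each $t$ there is a unique point $\bar x_t$ with $\bar x_t\in\operatorname{argmin}_{u\in\mathbb{R}^d}\{f_{t,\bar x_t}(u)+r_t(u)\}$. Algorithm (decision-dependent proximal stochastic gradient method). Given $x_0$ and step sizes $\eta_t>0$, at each step $t\ge0$ a stochastic gradient $g_t$ (estimator of $\nabla f_{t,x_t}(x_t)$) is obtained and $$x_{t+1}=\operatorname{prox}_{\eta_t r_t}(x_t-\eta_t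 g_t)=\operatorname{argmin}_{u\in\mathbb{R}^d}\left\{r_t(u)+\tfrac{1}{2\eta_t}\|u-(x_t-\eta_t g_t)\|^2\right\}.$$ The gradient noise is $z_t:=\nabla f_{t,x_t}(x_t)-g_t$. Stochastic framework. There is a probability space $(\Omega,\mathcal{F},\mathbb{P})$ with filtration $(\mathcal{F}_t)_{t\ge0}$, $\mathcal{F}_0=\{\emptyset,\Omega\}$, such that for all $t\ge0$: $x_t,\bar x_t\colon\Omega\to\mathbb{R}^d$ are $\mathcal{F}_t$-measurable, and $z_t\colon\Omega\to\mathbb{R}^d$ is $\mathcal{F}_{t+1}$-measurable with $\mathbb{E}[z_t\mid\mathcal{F}_t]=0$. *)

theory Defs
  imports "HOL-Probability.Probability"
begin

definition gradient :: "('a::euclidean_space \<Rightarrow> real) \<Rightarrow> 'a \<Rightarrow> 'a" where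
  "gradient h u = (THE D. GDERIV h u :> D)"

definition strongly_convex :: "real \<Rightarrow> ('a::euclidean_space \<Rightarrow> real) \<Rightarrow> bool" where
  "strongly_convex \<mu> h \<longleftrightarrow>
     (\<forall>u v. \<forall>s\<in>{0..1}. h ((1 - s) *\<^sub>R u + s *\<^sub>R v)
        \<le> (1 - s) * h u + s * h v - \<mu> / 2 * s * (1 - s) * (norm (u - v))\<^sup>2)"

text \<open>Continuity of the gradient is part of its Lipschitz continuity.\<close>

definition smooth :: "real \<Rightarrow> ('a::euclidean_space \<Rightarrow> real) \<Rightarrow> bool" where
  "smooth L h \<longleftrightarrow> (\<forall>u. h differentiable (at u)) \<and> L-lipschitz_on UNIV (gradient h)"

definition epi :: "('a::euclidean_space \<Rightarrow> ereal) \<Rightarrow> ('a \<times> real) set" where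
  "epi \<rho> = {(u, a). \<rho> u \<le> ereal a}"

definition proper_closed_convex :: "('a::euclidean_space \<Rightarrow> ereal) \<Rightarrow> bool" where
  "proper_closed_convex \<rho> \<longleftrightarrow>
     (\<forall>u. \<rho> u \<noteq> - \<infinity>) \<and> (\<exists>u. \<rho> u \<noteq> \<infinity>) \<and> closed (epi \<rho>) \<and> convex (epi \<rho>)"

text \<open>
  In the following, \<open>f t \<omega> x\<close> is the function \<open>f\<^sub>t\<^sub>,\<^sub>x\<close> and \<open>r t \<omega>\<close> the regularizer \<open>r\<^sub>t\<close> in the
  outcome \<open>\<omega>\<close>. The supremum ranges over the outcomes as well, since \<open>\<gamma>\<close> is deterministic; it is
  taken in the extended reals, so that it is meaningful even if the quotients are unbounded.
\<close>

definition gradient_sensitivity ::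
    "'w set \<Rightarrow> (nat \<Rightarrow> 'w \<Rightarrow> 'a \<Rightarrow> 'a::euclidean_space \<Rightarrow> real) \<Rightarrow> ereal" where
  "gradient_sensitivity \<Omega> f =
     (SUP (t, \<omega>, u, x, y) \<in> {(t, \<omega>, u, x, y). \<omega> \<in> \<Omega> \<and> x \<noteq> y}.
        ereal (norm (gradient (f t \<omega> x) u - gradient (f t \<omega> y) u) / norm (x - y)))"

locale problem_family =
  fixes \<Omega> :: "'w set"
    and f :: "nat \<Rightarrow> 'w \<Rightarrow> 'a \<Rightarrow> 'a::euclidean_space \<Rightarrow> real"
    and r :: "nat \<Rightarrow> 'w \<Rightarrow> 'a \<Rightarrow> ereal"
    and \<mu> L \<gamma> :: real
  assumes \<mu>_pos: "0 < \<mu>"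
    and L_pos: "0 < L"
    and f_strongly_convex: "\<omega> \<in> \<Omega> \<Longrightarrow> strongly_convex \<mu> (f t \<omega> x)"
    and f_smooth: "\<omega> \<in> \<Omega> \<Longrightarrow> smooth L (f t \<omega> x)"
    and r_proper_closed_convex: "\<omega> \<in> \<Omega> \<Longrightarrow> proper_closed_convex (r t \<omega>)"
    and \<gamma>_eq: "ereal \<gamma> = gradient_sensitivity \<Omega> f"
    and \<gamma>_less: "\<gamma> < \<mu>"

definition equilibrium :: "('a \<Rightarrow> 'a::euclidean_space \<Rightarrow> real) \<Rightarrow> ('a \<Rightarrow> ereal) \<Rightarrow> 'a \<Rightarrow> bool" where
  "equilibrium \<phi> \<rho> p \<longleftrightarrow> is_arg_min (\<lambda>u. ereal (\<phi> p u) + \<rho> u) (\<lambda>_. True) p"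

definition prox :: "real \<Rightarrow> ('a::euclidean_space \<Rightarrow> ereal) \<Rightarrow> 'a \<Rightarrow> 'a" where
  "prox \<eta> \<rho> y = arg_min (\<lambda>u. \<rho> u + ereal (1 / (2 * \<eta>) * (norm (u - y))\<^sup>2)) (\<lambda>_. True)"

definition gradient_noise ::
    "(nat \<Rightarrow> 'w \<Rightarrow> 'a \<Rightarrow> 'a::euclidean_space \<Rightarrow> real) \<Rightarrow> (nat \<Rightarrow> 'w \<Rightarrow> 'a) \<Rightarrow> (nat \<Rightarrow> 'w \<Rightarrow> 'a)
       \<Rightarrow> nat \<Rightarrow> 'w \<Rightarrow> 'a" where
  "gradient_noise f x g t \<omega> = gradient (f t \<omega> (x t \<omega>)) (x t \<omega>) - g t \<omega>"

definition prox_gradient_iterates ::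
    "'w set \<Rightarrow> (nat \<Rightarrow> 'w \<Rightarrow> 'a::euclidean_space \<Rightarrow> ereal) \<Rightarrow> (nat \<Rightarrow> real)
       \<Rightarrow> (nat \<Rightarrow> 'w \<Rightarrow> 'a) \<Rightarrow> (nat \<Rightarrow> 'w \<Rightarrow> 'a) \<Rightarrow> bool" where
  "prox_gradient_iterates \<Omega> r \<eta> x g \<longleftrightarrow>
     (\<forall>t. \<forall>\<omega>\<in>\<Omega>. x (Suc t) \<omega> = prox (\<eta> t) (r t \<omega>) (x t \<omega> - \<eta> t *\<^sub>R g t \<omega>))"

text \<open>Conditional expectation of a vector-valued random variable, taken coordinatewise.\<close>

definition vec_cond_exp ::
    "'w measure \<Rightarrow> 'w measure \<Rightarrow> ('w \<Rightarrow> 'a::euclidean_space) \<Rightarrow> 'w \<Rightarrow> 'a" where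
  "vec_cond_exp M G X \<omega> = (\<Sum>b\<in>Basis. real_cond_exp M G (\<lambda>\<omega>'. X \<omega>' \<bullet> b) \<omega> *\<^sub>R b)"

text \<open>
  Integrability of \<open>z t\<close> is what makes its conditional expectation meaningful
  (\<^const>\<open>real_cond_exp\<close> takes arbitrary values on non-integrable functions).
\<close>

locale stochastic_framework = prob_space M + filtration "space M" F
  for M :: "'w measure" and F :: "nat \<Rightarrow> 'w measure" +
  fixes x xbar z :: "nat \<Rightarrow> 'w \<Rightarrow> 'a::euclidean_space"
  assumes subalgebra_F: "subalgebra M (F t)"
    and F_0: "sets (F 0) = {{}, space M}"
    and x_measurable: "x t \<in> borel_measurable (F t)"
    and xbar_measurable: "xbar t \<in> borel_measurable (F t)"
    and z_measurable: "z t \<in> borel_measurable (F (Suc t))"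
    and z_integrable: "integrable M (z t)"
    and z_mean_zero: "AE \<omega> in M. vec_cond_exp M (F t) (z t) \<omega> = 0"

text \<open>
  A constant bound by an existential quantifier may still depend on the type variables of the
  statement, here on the type of the sample space and on the Euclidean space, hence on the
  dimension. A bound by a fixed numeral makes it an absolute constant: the estimate in question is
  monotone in the constant, so that one value then serves all types. The value of the numeral is
  generous and has no significance of its own.
\<close>

definition absolute_cap :: real where
  "absolute_cap = 10"

end

theory Submission
  imports Defs
begin

text \<open>
  Put \<open>V\<^sub>t = \<parallel>x\<^sub>t - xbar\<^sub>t\<parallel>\<^sup>2\<close> and \<open>a = (\<mu> - \<gamma>) \<eta> \<le> 1/2\<close>. Optimality of the proximal step and of the
  equilibrium give \<open>V\<^sub>t\<^sub>+\<^sub>1 \<le> (1 - a) V\<^sub>t + 2 \<eta> \<langle>x\<^sub>t - xbar\<^sub>t, z\<^sub>t\<rangle> + 2 \<eta>\<^sup>2 \<parallel>z\<^sub>t\<parallel>\<^sup>2 + 3/(2a) \<Delta>\<^sub>t\<^sup>2\<close>. The tail bound makes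
  \<open>z\<^sub>t\<close> conditionally sub-Gaussian, so for small \<open>\<kappa>\<close> the linear noise term costs at most a factor
  \<open>exp (\<kappa> (a/2) V\<^sub>t)\<close> and \<open>E exp (\<kappa> V\<^sub>t\<^sub>+\<^sub>1) \<le> exp (\<kappa> C) E exp (\<kappa> (1 - a/2) V\<^sub>t)\<close>. Iterating and applying
  Markov's inequality to \<open>exp (\<kappa> V\<^sub>t)\<close> gives the estimate. Conditional bounds are used in integrated
  form, against arbitrary nonnegative weights measurable with respect to the past.
\<close>

section \<open>Gradients, strong convexity and smoothness\<close>

text \<open>The obstacle is that the linear noise term fluctuates on the scale of
  \<open>norm (x t - xbar t)\<close>: its variance proxy is proportional to the very quantity to be
  controlled, for which no moments are assumed. With moment parameter \<kappa> it costs a multiple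
  of \<open>\<kappa>\<^sup>2\<close> times the squared error, while contraction gains a multiple of
  \<kappa>. The cost is therefore absorbed only for small \<kappa>, and half of the contraction is
  spent on it, whence the rate \<open>1 - a / 2\<close>. The admissible size of \<kappa> sets the
  tail scale \<open>1 / \<kappa>\<close>, of order
  \<open>\<eta>\<^sup>2 * \<sigma>\<^sup>2 / a + \<Delta>\<^sup>2 / a\<close>. The additive cost C
  of a step sums along the geometric series to \<open>2 * C / a\<close>. One coefficient bounds
  both; the sum is taken once and the tail scale \<open>ln (1 / \<delta>)\<close> times, which is
  the origin of \<open>ln (exp 1 / \<delta>)\<close>. Nonnegative integrals allow moment bounds to
  be stated before any integrability is known.\<close>

lemma GDERIV_gradient:
  fixes h :: "'a::euclidean_space \<Rightarrow> real"
  assumes "h differentiable (at u)"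
  shows "GDERIV h u :> gradient h u"
proof -
  obtain h' where h': "(h has_derivative h') (at u)"
    using assms by (auto simp: differentiable_def)
  interpret bounded_linear h' by (rule has_derivative_bounded_linear[OF h'])
  \<comment> \<open>The coordinates of the derivative assemble its Riesz representative. Uniqueness,
    shown below by testing with \<open>D' - D\<close>, makes the definite description in
    \<open>gradient\<close> denote it.\<close>
  define D where "D = (\<Sum>b\<in>Basis. h' b *\<^sub>R b)"
  have "h' = (\<lambda>v. v \<bullet> D)"
  proof
    fix v
    have "h' v = h' (\<Sum>b\<in>Basis. (v \<bullet> b) *\<^sub>R b)" by (simp add: euclidean_representation)
    also have "\<dots> = (\<Sum>b\<in>Basis. (v \<bullet> b) * h' b)" by (simp add: sum scaleR)
    also have "\<dots> = v \<bullet> D" by (simp add: D_def inner_sum_right mult.commute)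
    finally show "h' v = v \<bullet> D" .
  qed
  then have D: "GDERIV h u :> D" using h' by (simp add: gderiv_def)
  have "D' = D" if "GDERIV h u :> D'" for D'
  proof -
    have "(\<lambda>v. v \<bullet> D') = (\<lambda>v. v \<bullet> D)"
      using has_derivative_unique that D unfolding gderiv_def by blast
    then have "(D' - D) \<bullet> D' = (D' - D) \<bullet> D" by metis
    then have "(D' - D) \<bullet> (D' - D) = 0" by (simp add: inner_diff_right)
    then show ?thesis by simp
  qed
  with D show ?thesis unfolding gradient_def by (rule theI)
qed

lemma GDERIV_along_line:
  fixes h :: "'a::euclidean_space \<Rightarrow> real"
  assumes "GDERIV h (u + s *\<^sub>R d) :> D"
  shows "((\<lambda>s. h (u + s *\<^sub>R d)) has_real_derivative d \<bullet> D) (at s)"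
proof -
  have "((\<lambda>s. u + s *\<^sub>R d) has_derivative (\<lambda>s. s *\<^sub>R d)) (at s)"
    by (auto intro!: derivative_eq_intros)
  from has_derivative_compose[OF this assms[unfolded gderiv_def]]
  moreover have "(\<lambda>s. s *\<^sub>R d \<bullet> D) = (*) (d \<bullet> D)" by (simp add: fun_eq_iff)
  ultimately show ?thesis by (simp add: has_field_derivative_def)
qed

lemma directional_quotient_tendsto:
  fixes h :: "'a::euclidean_space \<Rightarrow> real"
  assumes "GDERIV h u :> D"
  shows "((\<lambda>s. (h (u + s *\<^sub>R d) - h u) / s) \<longlongrightarrow> d \<bullet> D) (at_right 0)"
proof -
  have "((\<lambda>s. h (u + s *\<^sub>R d)) has_real_derivative d \<bullet> D) (at 0)"
    using GDERIV_along_line[of h u 0 d D] assms by simp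
  then have "((\<lambda>s. (h (u + s *\<^sub>R d) - h u) / s) \<longlongrightarrow> d \<bullet> D) (at 0)"
    by (simp add: DERIV_def)
  then show ?thesis by (rule filterlim_mono) (auto simp: at_le)
qed

text \<open>The convexity inequality on the segment from u to v, divided by s, bounds a one-sided
  difference quotient. The factor \<open>1 - s\<close> tends to 1, so the full modulus survives the
  limit.\<close>

lemma strongly_convex_gradient_le:
  fixes h :: "'a::euclidean_space \<Rightarrow> real"
  assumes "strongly_convex \<mu> h" and D: "GDERIV h u :> D"
  shows "h u + (v - u) \<bullet> D + \<mu> / 2 * (norm (v - u))\<^sup>2 \<le> h v"
proof -
  have le: "(h (u + s *\<^sub>R (v - u)) - h u) / s \<le> h v - h u - \<mu> / 2 * (1 - s) * (norm (u - v))\<^sup>2"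
    if "0 < s" "s < 1" for s
  proof -
    have "h ((1 - s) *\<^sub>R u + s *\<^sub>R v)
        \<le> (1 - s) * h u + s * h v - \<mu> / 2 * s * (1 - s) * (norm (u - v))\<^sup>2"
      using assms(1) that by (simp add: strongly_convex_def)
    moreover have "(1 - s) *\<^sub>R u + s *\<^sub>R v = u + s *\<^sub>R (v - u)" by (simp add: algebra_simps)
    ultimately have "h (u + s *\<^sub>R (v - u)) - h u
        \<le> s * (h v - h u - \<mu> / 2 * (1 - s) * (norm (u - v))\<^sup>2)"
      by (simp add: algebra_simps)
    with that show ?thesis by (simp add: divide_le_eq mult.commute)
  qed
  have "((\<lambda>s. h v - h u - \<mu> / 2 * (1 - s) * (norm (u - v))\<^sup>2)
      \<longlongrightarrow> h v - h u - \<mu> / 2 * (1 - 0) * (norm (u - v))\<^sup>2) (at_right 0)"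
    by (intro tendsto_intros)
  then have "(v - u) \<bullet> D \<le> h v - h u - \<mu> / 2 * (1 - 0) * (norm (u - v))\<^sup>2"
    by (rule tendsto_le[OF trivial_limit_at_right_real _ directional_quotient_tendsto[OF D]])
      (rule eventually_at_rightI[of 0 1], rule le, auto)
  then show ?thesis by (simp add: norm_minus_commute)
qed

text \<open>Along the segment, \<open>\<psi>\<close> is h minus the linear and quadratic terms of
  the majorant. Cauchy-Schwarz and the Lipschitz gradient make its derivative nonpositive, so
  comparing the end points suffices.\<close>

lemma smooth_upper_quadratic:
  fixes h :: "'a::euclidean_space \<Rightarrow> real"
  assumes "smooth L h"
  shows "h v \<le> h u + (v - u) \<bullet> gradient h u + L / 2 * (norm (v - u))\<^sup>2"
proof -
  define d where "d = v - u"
  define \<psi> where "\<psi> s = h (u + s *\<^sub>R d) - s * (d \<bullet> gradient h u) - s\<^sup>2 * (L / 2 * (norm d)\<^sup>2)" for s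
  have G: "GDERIV h w :> gradient h w" for w
    using assms by (auto simp: smooth_def intro: GDERIV_gradient)
  have "\<psi> 1 \<le> \<psi> 0"
  proof (rule DERIV_nonpos_imp_nonincreasing[of 0 1])
    fix s :: real assume s: "0 \<le> s" "s \<le> 1"
    let ?y = "d \<bullet> gradient h (u + s *\<^sub>R d) - d \<bullet> gradient h u - 2 * s * (L / 2 * (norm d)\<^sup>2)"
    have "(\<psi> has_real_derivative ?y) (at s)"
      unfolding \<psi>_def by (auto intro!: derivative_eq_intros GDERIV_along_line[OF G])
    moreover have "?y \<le> 0"
    proof -
      have "d \<bullet> gradient h (u + s *\<^sub>R d) - d \<bullet> gradient h u
          \<le> norm d * norm (gradient h (u + s *\<^sub>R d) - gradient h u)"
        using norm_cauchy_schwarz[of d "gradient h (u + s *\<^sub>R d) - gradient h u"]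
        by (simp add: inner_diff_right)
      also have "\<dots> \<le> norm d * (L * norm (s *\<^sub>R d))"
        using assms lipschitz_onD[of L UNIV "gradient h" "u + s *\<^sub>R d" u]
        by (intro mult_left_mono) (simp_all add: smooth_def dist_norm)
      finally show ?thesis using s
        by (simp add: power2_eq_square algebra_simps)
    qed
    ultimately show "\<exists>y. (\<psi> has_real_derivative y) (at s) \<and> y \<le> 0" by blast
  qed simp
  then show ?thesis by (simp add: \<psi>_def d_def)
qed

text \<open>The quadratic lower and upper bounds at 0 are compared at a point of norm 1. This is
  what later bounds the contraction a by \<open>1 / 2\<close>.\<close>

lemma strongly_convex_smooth_le:
  fixes h :: "'a::euclidean_space \<Rightarrow> real"
  assumes "strongly_convex \<mu> h" "smooth L h"
  shows "\<mu> \<le> L"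
proof -
  obtain b :: 'a where b: "b \<in> Basis" using nonempty_Basis by blast
  have G: "GDERIV h 0 :> gradient h 0"
    using assms by (auto simp: smooth_def intro: GDERIV_gradient)
  show ?thesis
    using strongly_convex_gradient_le[OF assms(1) G, of b] smooth_upper_quadratic[OF assms(2), of b 0] b
    by simp
qed

section \<open>Optimality conditions and the proximal map\<close>

lemma minimizer_finite:
  assumes \<rho>: "proper_closed_convex \<rho>"
    and p: "is_arg_min (\<lambda>u. \<rho> u + ereal (\<phi> u)) (\<lambda>_. True) p"
  shows "\<bar>\<rho> p\<bar> \<noteq> \<infinity>"
proof -
  obtain u where "\<rho> u \<noteq> \<infinity>" using \<rho> by (auto simp: proper_closed_convex_def)
  moreover have "\<not> \<rho> u + ereal (\<phi> u) < \<rho> p + ereal (\<phi> p)"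
    using p by (auto simp: is_arg_min_def)
  ultimately show ?thesis
    using \<rho> by (cases "\<rho> u"; cases "\<rho> p") (auto simp: proper_closed_convex_def)
qed

text \<open>In other words, \<open>- D\<close> is a subgradient of \<rho> at p; minimality is tested
  on short segments towards u. Epigraph heights a and b keep the arithmetic real, and an infinite
  value at u requires no separate case.\<close>

lemma first_order_optimality:
  fixes \<phi> :: "'a::euclidean_space \<Rightarrow> real"
  assumes \<rho>: "proper_closed_convex \<rho>"
    and p: "is_arg_min (\<lambda>u. \<rho> u + ereal (\<phi> u)) (\<lambda>_. True) p"
    and D: "GDERIV \<phi> p :> D"
    and a: "\<rho> p = ereal a" and b: "\<rho> u \<le> ereal b"
  shows "a - (u - p) \<bullet> D \<le> b"
proof -
  have le: "a - b \<le> (\<phi> (p + s *\<^sub>R (u - p)) - \<phi> p) / s" if s: "0 < s" "s < 1" for s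
  proof -
    have "(p, a) \<in> epi \<rho>" "(u, b) \<in> epi \<rho>" using a b by (auto simp: epi_def)
    then have "(1 - s) *\<^sub>R (p, a) + s *\<^sub>R (u, b) \<in> epi \<rho>"
      using \<rho> s by (intro convexD) (auto simp: proper_closed_convex_def)
    then have "(p + s *\<^sub>R (u - p), (1 - s) * a + s * b) \<in> epi \<rho>"
      by (simp add: algebra_simps)
    then have "\<rho> (p + s *\<^sub>R (u - p)) \<le> ereal ((1 - s) * a + s * b)"
      by (simp add: epi_def)
    moreover have "\<not> \<rho> (p + s *\<^sub>R (u - p)) + ereal (\<phi> (p + s *\<^sub>R (u - p))) < \<rho> p + ereal (\<phi> p)"
      using p by (auto simp: is_arg_min_def)
    ultimately have "a + \<phi> p \<le> (1 - s) * a + s * b + \<phi> (p + s *\<^sub>R (u - p))"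
      using a by (cases "\<rho> (p + s *\<^sub>R (u - p))") auto
    then have "s * (a - b) \<le> \<phi> (p + s *\<^sub>R (u - p)) - \<phi> p" by (simp add: algebra_simps)
    with s show ?thesis by (simp add: le_divide_eq mult.commute)
  qed
  have "a - b \<le> (u - p) \<bullet> D"
    by (rule tendsto_lowerbound[OF directional_quotient_tendsto[OF D]])
      (auto intro!: eventually_at_rightI[of 0 1] le)
  then show ?thesis by simp
qed

text \<open>\<open>prox\<close> is a choice, so it yields a minimizer only once one exists.
  Coercivity comes from an affine minorant of \<rho>, which the application takes from optimality of
  the equilibrium instead of a separation argument. Working on the epigraph replaces a lower
  semicontinuous objective by the continuous \<open>\<Phi>\<close> on a closed set.\<close>

lemma proximal_minimizer_exists:
  fixes \<rho> :: "'a::euclidean_space \<Rightarrow> ereal"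
  assumes \<rho>: "proper_closed_convex \<rho>" and \<eta>: "0 < \<eta>"
    and minorant: "\<And>u b. \<rho> u \<le> ereal b \<Longrightarrow> a - (u - q) \<bullet> D \<le> b"
  shows "\<exists>p. is_arg_min (\<lambda>u. \<rho> u + ereal (1 / (2 * \<eta>) * (norm (u - y))\<^sup>2)) (\<lambda>_. True) p"
proof -
  define \<Phi> :: "'a \<times> real \<Rightarrow> real" where "\<Phi> w = snd w + 1 / (2 * \<eta>) * (norm (fst w - y))\<^sup>2" for w
  have real_epi: "\<exists>b. \<rho> u = ereal b" if "\<rho> u \<noteq> \<infinity>" for u
    using \<rho> that by (cases "\<rho> u") (auto simp: proper_closed_convex_def)
  obtain u0 b0 where u0: "\<rho> u0 = ereal b0"
    using \<rho> real_epi unfolding proper_closed_convex_def by metis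
  define S where "S = epi \<rho> \<inter> {w. \<Phi> w \<le> \<Phi> (u0, b0)}"
  \<comment> \<open>C is the level minus the minorant at y. On S the distance n to y satisfies
    \<open>n\<^sup>2 \<le> 2 * \<eta> * \<bar>C\<bar> + 2 * \<eta> * norm D * n\<close>; R, the
    linear coefficient plus the root of the constant term, bounds every such n.\<close>
  define C where "C = \<Phi> (u0, b0) - (a - (y - q) \<bullet> D)"
  define R where "R = 2 * \<eta> * norm D + sqrt (2 * \<eta> * \<bar>C\<bar>)"
  have \<Phi>_cont: "continuous_on UNIV \<Phi>" unfolding \<Phi>_def by (intro continuous_intros)
  have "closed S"
  proof -
    have "closed {w. \<Phi> w \<le> \<Phi> (u0, b0)}"
      using \<Phi>_cont by (intro closed_Collect_le) auto
    with \<rho> show ?thesis by (auto simp: S_def proper_closed_convex_def)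
  qed
  moreover have "bounded S"
  proof -
    have "norm (u - y) \<le> R \<and> \<bar>b\<bar> \<le> \<bar>\<Phi> (u0, b0)\<bar> + \<bar>a - (y - q) \<bullet> D\<bar> + R * norm D"
      if "(u, b) \<in> S" for u b
    proof -
      let ?n = "norm (u - y)"
      have "\<rho> u \<le> ereal b" and \<Phi>: "b + 1 / (2 * \<eta>) * ?n\<^sup>2 \<le> \<Phi> (u0, b0)"
        using that by (auto simp: S_def epi_def \<Phi>_def)
      from minorant[OF this(1)] have "a - (y - q) \<bullet> D - (u - y) \<bullet> D \<le> b"
        by (simp add: algebra_simps)
      moreover have "(u - y) \<bullet> D \<le> ?n * norm D" by (rule norm_cauchy_schwarz)
      ultimately have b: "a - (y - q) \<bullet> D - ?n * norm D \<le> b" by simp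
      with \<Phi> have "1 / (2 * \<eta>) * ?n\<^sup>2 \<le> \<bar>C\<bar> + ?n * norm D" by (simp add: C_def)
      then have quad: "?n\<^sup>2 \<le> 2 * \<eta> * \<bar>C\<bar> + (2 * \<eta> * norm D) * ?n"
        using \<eta> by (simp add: field_simps)
      have n: "?n \<le> R"
      proof (rule ccontr)
        assume "\<not> ?n \<le> R"
        then have gt: "sqrt (2 * \<eta> * \<bar>C\<bar>) < ?n - 2 * \<eta> * norm D" by (simp add: R_def)
        have "2 * \<eta> * \<bar>C\<bar> = sqrt (2 * \<eta> * \<bar>C\<bar>) * sqrt (2 * \<eta> * \<bar>C\<bar>)" using \<eta> by simp
        also have "\<dots> < ?n * (?n - 2 * \<eta> * norm D)"
        proof (rule mult_strict_mono)
          have "0 \<le> 2 * \<eta> * norm D" using \<eta> by simp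
          with gt show "sqrt (2 * \<eta> * \<bar>C\<bar>) < ?n" by linarith
          show "0 \<le> sqrt (2 * \<eta> * \<bar>C\<bar>)" using \<eta> by simp
          show "0 < ?n" using gt \<open>0 \<le> 2 * \<eta> * norm D\<close> \<open>0 \<le> sqrt (2 * \<eta> * \<bar>C\<bar>)\<close> by linarith
        qed (use gt in auto)
        finally show False using quad by (simp add: algebra_simps power2_eq_square)
      qed
      have "?n * norm D \<le> R * norm D" using n by (rule mult_right_mono) simp
      moreover have "b \<le> \<Phi> (u0, b0)"
      proof -
        have "0 \<le> 1 / (2 * \<eta>) * ?n\<^sup>2" using \<eta> by simp
        with \<Phi> show ?thesis by linarith
      qed
      moreover have "0 \<le> R * norm D" using \<eta> by (simp add: R_def)
      ultimately show ?thesis using n b by linarith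
    qed
    then have "S \<subseteq> cball y R \<times> cball 0 (\<bar>\<Phi> (u0, b0)\<bar> + \<bar>a - (y - q) \<bullet> D\<bar> + R * norm D)"
      by (auto simp: dist_norm norm_minus_commute)
    then show ?thesis using bounded_Times[OF bounded_cball bounded_cball] bounded_subset by blast
  qed
  ultimately have "compact S" by (simp add: compact_eq_bounded_closed)
  moreover have mem: "(u0, b0) \<in> S" using u0 by (simp add: S_def epi_def)
  ultimately obtain w where w: "w \<in> S" and w_min: "\<And>w'. w' \<in> S \<Longrightarrow> \<Phi> w \<le> \<Phi> w'"
    using continuous_attains_inf[of S \<Phi>] \<Phi>_cont continuous_on_subset by blast
  have w_min': "\<Phi> w \<le> \<Phi> w'" if "w' \<in> epi \<rho>" for w'
    using that w_min[of w'] w_min[OF mem] by (cases "w' \<in> S") (auto simp: S_def)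
  obtain p c where wp: "w = (p, c)" by (cases w)
  have pc: "\<rho> p \<le> ereal c" using w by (simp add: wp S_def epi_def)
  have "\<not> \<rho> u + ereal (1 / (2 * \<eta>) * (norm (u - y))\<^sup>2)
      < \<rho> p + ereal (1 / (2 * \<eta>) * (norm (p - y))\<^sup>2)" for u
  proof (cases "\<rho> u = \<infinity>")
    case False
    then obtain b where b: "\<rho> u = ereal b" using real_epi by blast
    then have "\<Phi> (p, c) \<le> \<Phi> (u, b)" using w_min'[of "(u, b)"] by (simp add: wp epi_def)
    then have *: "c + 1 / (2 * \<eta>) * (norm (p - y))\<^sup>2 \<le> b + 1 / (2 * \<eta>) * (norm (u - y))\<^sup>2"
      by (simp add: \<Phi>_def)
    have "\<rho> p + ereal (1 / (2 * \<eta>) * (norm (p - y))\<^sup>2) \<le> ereal (c + 1 / (2 * \<eta>) * (norm (p - y))\<^sup>2)"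
      using add_right_mono[OF pc, of "ereal (1 / (2 * \<eta>) * (norm (p - y))\<^sup>2)"] by simp
    also have "\<dots> \<le> \<rho> u + ereal (1 / (2 * \<eta>) * (norm (u - y))\<^sup>2)" using * b by simp
    finally show ?thesis by simp
  qed simp
  then show ?thesis by (auto simp: is_arg_min_def)
qed

lemma GDERIV_norm_square: "GDERIV (\<lambda>u. k * (norm (u - y))\<^sup>2) p :> (2 * k) *\<^sub>R (p - y)"
  unfolding gderiv_def power2_norm_eq_inner
  by (auto intro!: derivative_eq_intros simp: fun_eq_iff inner_commute algebra_simps)

text \<open>Both q and p satisfy a variational inequality for the same \<rho>, and each is the test
  point of the other. In the sum the values of \<rho> cancel: monotonicity of the
  subdifferential.\<close>

lemma prox_optimality:
  fixes \<rho> :: "'a::euclidean_space \<Rightarrow> ereal"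
  assumes \<rho>: "proper_closed_convex \<rho>" and \<eta>: "0 < \<eta>"
    and q: "is_arg_min (\<lambda>u. \<rho> u + ereal (\<phi> u)) (\<lambda>_. True) q"
    and D: "GDERIV \<phi> q :> D"
    and p: "p = prox \<eta> \<rho> y"
  shows "(p - y) \<bullet> (p - q) \<le> \<eta> * (D \<bullet> (p - q))"
proof -
  obtain a where a: "\<rho> q = ereal a" using minimizer_finite[OF \<rho> q] by (cases "\<rho> q") auto
  have "is_arg_min (\<lambda>u. \<rho> u + ereal (1 / (2 * \<eta>) * (norm (u - y))\<^sup>2)) (\<lambda>_. True) p"
    unfolding p prox_def arg_min_def
    by (rule someI_ex, rule proximal_minimizer_exists[OF \<rho> \<eta>])
      (rule first_order_optimality[OF \<rho> q D a])
  note p_min = this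
  obtain b where b: "\<rho> p = ereal b" using minimizer_finite[OF \<rho> p_min] by (cases "\<rho> p") auto
  have "a - (p - q) \<bullet> D \<le> b"
    by (rule first_order_optimality[OF \<rho> q D a]) (simp add: b)
  moreover have "b - (q - p) \<bullet> ((2 * (1 / (2 * \<eta>))) *\<^sub>R (p - y)) \<le> a"
    by (rule first_order_optimality[OF \<rho> p_min GDERIV_norm_square b]) (simp add: a)
  ultimately have "((p - y) \<bullet> (p - q)) / \<eta> \<le> D \<bullet> (p - q)"
    using \<eta> by (simp add: inner_diff_left inner_diff_right inner_commute diff_divide_distrib)
  with \<eta> show ?thesis
    by (simp add: divide_le_eq mult.commute)
qed

section \<open>One-step contraction towards a moving equilibrium\<close>

lemma gradient_sensitivity_bound:
  assumes "ereal \<gamma> = gradient_sensitivity \<Omega> f" "\<omega> \<in> \<Omega>"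
  shows "norm (gradient (f t \<omega> x) u - gradient (f t \<omega> y) u) \<le> \<gamma> * norm (x - y)"
proof (cases "x = y")
  case False
  have "ereal (norm (gradient (f t \<omega> x) u - gradient (f t \<omega> y) u) / norm (x - y)) \<le> ereal \<gamma>"
    unfolding assms(1) gradient_sensitivity_def
    by (rule SUP_upper2[of "(t, \<omega>, u, x, y)"]) (use False assms(2) in auto)
  with False show ?thesis by (simp add: divide_le_eq)
qed simp

text \<open>
  The noise enters linearly only through \<open>\<langle>x - q, z\<rangle>\<close>, not through differences of gradients: the
  gradients need not be measurable with respect to the past, whereas \<open>x\<close> and \<open>q\<close> are.
\<close>

lemma prox_gradient_step:
  fixes f :: "'a::euclidean_space \<Rightarrow> 'a \<Rightarrow> real"
  assumes sc: "\<And>y. strongly_convex \<mu> (f y)" and sm: "\<And>y. smooth L (f y)"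
    and \<rho>: "proper_closed_convex \<rho>"
    and sens: "\<And>u y y'. norm (gradient (f y) u - gradient (f y') u) \<le> \<gamma> * norm (y - y')"
    and \<gamma>: "0 \<le> \<gamma>" and L: "0 < L" and \<eta>: "0 < \<eta>" "\<eta> \<le> 1 / (2 * L)"
    and q: "equilibrium f \<rho> q"
    and p: "p = prox \<eta> \<rho> (x - \<eta> *\<^sub>R g)" and z: "z = gradient (f x) x - g"
  shows "(1 + \<eta> * (\<mu> - \<gamma>)) * (norm (p - q))\<^sup>2
    \<le> (1 - \<eta> * (\<mu> - \<gamma>)) * (norm (x - q))\<^sup>2 + 2 * \<eta> * ((x - q) \<bullet> z) + 2 * \<eta>\<^sup>2 * (norm z)\<^sup>2"
proof -
  have G: "GDERIV (f q) w :> gradient (f q) w" for w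
    using sm[of q] by (auto simp: smooth_def intro: GDERIV_gradient)
  have q': "is_arg_min (\<lambda>u. \<rho> u + ereal (f q u)) (\<lambda>_. True) q"
    using q by (simp add: equilibrium_def add.commute)
  \<comment> \<open>\<open>G1\<close> is the change of gradient due to the decision, controlled by
    \<gamma>; \<open>G2\<close> compares two gradients of one function, where convexity and
    smoothness apply.\<close>
  define G1 where "G1 = gradient (f x) x - gradient (f q) x"
  define G2 where "G2 = gradient (f q) x - gradient (f q) q"
  have opt: "(p - (x - \<eta> *\<^sub>R g)) \<bullet> (p - q) \<le> \<eta> * (gradient (f q) q \<bullet> (p - q))"
    by (rule prox_optimality[OF \<rho> \<eta>(1) q' G p])
  have "p - (x - \<eta> *\<^sub>R g) = (p - x) + \<eta> *\<^sub>R (G1 + G2 - z) + \<eta> *\<^sub>R gradient (f q) q"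
    by (simp add: G1_def G2_def z algebra_simps)
  with opt have 1: "(p - x) \<bullet> (p - q) + \<eta> * ((G1 + G2 - z) \<bullet> (p - q)) \<le> 0"
    by (simp add: inner_add_left)
  have 2: "2 * ((p - x) \<bullet> (p - q)) = (norm (p - x))\<^sup>2 + (norm (p - q))\<^sup>2 - (norm (x - q))\<^sup>2"
    unfolding power2_norm_eq_inner by (simp add: inner_diff_left inner_diff_right inner_commute)
  \<comment> \<open>Strong convexity is used from x to q and from q to p, smoothness from x to p;
    the function values cancel around the triangle. Curvature is thus gained at both
    \<open>x - q\<close> and \<open>p - q\<close>, at the price of \<open>p - x\<close>.\<close>
  have 3: "\<mu> / 2 * (norm (x - q))\<^sup>2 + \<mu> / 2 * (norm (p - q))\<^sup>2 - L / 2 * (norm (p - x))\<^sup>2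
      \<le> G2 \<bullet> (p - q)"
  proof -
    have "f q x + (q - x) \<bullet> gradient (f q) x + \<mu> / 2 * (norm (q - x))\<^sup>2 \<le> f q q"
      by (rule strongly_convex_gradient_le[OF sc G])
    moreover have "f q q + (p - q) \<bullet> gradient (f q) q + \<mu> / 2 * (norm (p - q))\<^sup>2 \<le> f q p"
      by (rule strongly_convex_gradient_le[OF sc G])
    moreover have "f q p \<le> f q x + (p - x) \<bullet> gradient (f q) x + L / 2 * (norm (p - x))\<^sup>2"
      by (rule smooth_upper_quadratic[OF sm])
    moreover have "(p - q) \<bullet> (gradient (f q) x - gradient (f q) q)
        = (p - x) \<bullet> gradient (f q) x - (q - x) \<bullet> gradient (f q) x - (p - q) \<bullet> gradient (f q) q"
      by (simp add: inner_diff_left inner_diff_right)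
    ultimately show ?thesis
      by (simp add: G2_def norm_minus_commute[of q x] inner_commute[of _ "p - q"])
  qed
  have 4: "- (G1 \<bullet> (p - q)) \<le> \<gamma> / 2 * ((norm (x - q))\<^sup>2 + (norm (p - q))\<^sup>2)"
  proof -
    have "- (G1 \<bullet> (p - q)) \<le> norm G1 * norm (p - q)"
      using norm_cauchy_schwarz[of "- G1" "p - q"] by simp
    also have "\<dots> \<le> (\<gamma> * norm (x - q)) * norm (p - q)"
      using sens[of x x q] by (intro mult_right_mono) (simp_all add: G1_def)
    also have "\<dots> = \<gamma> / 2 * (2 * norm (x - q) * norm (p - q))" by simp
    also have "\<dots> \<le> \<gamma> / 2 * ((norm (x - q))\<^sup>2 + (norm (p - q))\<^sup>2)"
      using \<gamma> by (intro mult_left_mono sum_squares_bound) auto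
    finally show ?thesis .
  qed
  \<comment> \<open>The noise is paired here with \<open>p - x\<close>, which depends on it, so this
    part must become quadratic. Fact \<open>2\<close> supplies one copy of
    \<open>(norm (p - x))\<^sup>2\<close>: half pays for this term, half for the smoothness loss in
    \<open>6\<close>, which is where \<open>\<eta> \<le> 1 / (2 * L)\<close> enters.\<close>
  have 5: "z \<bullet> (p - x) * (2 * \<eta>) \<le> 2 * \<eta>\<^sup>2 * (norm z)\<^sup>2 + 1 / 2 * (norm (p - x))\<^sup>2"
  proof -
    have "0 \<le> (norm ((2 * \<eta>) *\<^sub>R z - (p - x)))\<^sup>2" by simp
    also have "\<dots> = 4 * \<eta>\<^sup>2 * (norm z)\<^sup>2 - 4 * \<eta> * (z \<bullet> (p - x)) + (norm (p - x))\<^sup>2"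
      unfolding power2_norm_eq_inner
      by (simp add: inner_diff_left inner_diff_right inner_commute power2_eq_square algebra_simps)
    finally show ?thesis by argo
  qed
  have 6: "\<eta> * L * (norm (p - x))\<^sup>2 \<le> 1 / 2 * (norm (p - x))\<^sup>2"
    using \<eta> L by (intro mult_right_mono) (simp_all add: field_simps)
  have 7: "z \<bullet> (p - q) = z \<bullet> (p - x) + (x - q) \<bullet> z"
    by (simp add: inner_diff_right inner_commute)
  have 8: "(G1 + G2 - z) \<bullet> (p - q) = G1 \<bullet> (p - q) + G2 \<bullet> (p - q) - z \<bullet> (p - q)"
    by (simp add: inner_add_left inner_diff_left)
  have "\<eta> * (\<mu> / 2 * (norm (x - q))\<^sup>2 + \<mu> / 2 * (norm (p - q))\<^sup>2 - L / 2 * (norm (p - x))\<^sup>2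
      - \<gamma> / 2 * ((norm (x - q))\<^sup>2 + (norm (p - q))\<^sup>2)) \<le> \<eta> * (G1 \<bullet> (p - q) + G2 \<bullet> (p - q))"
    using 3 4 \<eta> by (intro mult_left_mono) auto
  then have "\<eta> * \<mu> * (norm (x - q))\<^sup>2 + \<eta> * \<mu> * (norm (p - q))\<^sup>2 - \<eta> * L * (norm (p - x))\<^sup>2
      - \<eta> * \<gamma> * (norm (x - q))\<^sup>2 - \<eta> * \<gamma> * (norm (p - q))\<^sup>2
      \<le> 2 * \<eta> * ((G1 + G2 - z) \<bullet> (p - q)) + 2 * \<eta> * (z \<bullet> (p - q))"
    unfolding 8 by (simp add: algebra_simps)
  with 1 2 5 6 show ?thesis unfolding 7 by (simp add: algebra_simps)
qed

lemma norm_add_square_le: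
  fixes u v :: "'a::real_inner"
  assumes a: "0 < a"
  shows "(norm (u + v))\<^sup>2 \<le> (1 + a) * (norm u)\<^sup>2 + (1 + 1 / a) * (norm v)\<^sup>2"
proof -
  have "0 \<le> (norm (a *\<^sub>R u - v))\<^sup>2" by simp
  also have "\<dots> = a * (a * (norm u)\<^sup>2 - 2 * (u \<bullet> v) + (norm v)\<^sup>2 / a)"
    using a unfolding power2_norm_eq_inner
    by (simp add: inner_diff_left inner_diff_right inner_commute power2_eq_square algebra_simps)
  finally have "2 * (u \<bullet> v) \<le> a * (norm u)\<^sup>2 + (norm v)\<^sup>2 / a"
    using a by (simp add: zero_le_mult_iff)
  then show ?thesis
    using a by (simp add: power2_norm_eq_inner inner_add_left inner_add_right inner_commute algebra_simps)
qed

text \<open>The factor \<open>1 + a\<close> on the left of the step inequality pays exactly for the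
  factor \<open>1 + a\<close> of the split at the moved equilibrium, so the contraction
  \<open>1 - a\<close> is kept. The drift factor is \<open>1 + 1 / a \<le> 3 / (2 * a)\<close>, by
  \<open>a \<le> 1 / 2\<close>.\<close>

lemma prox_gradient_tracking_step:
  fixes xb xb' x' x z :: "'a::real_inner"
  assumes a: "0 < a" "a \<le> 1 / 2"
    and step: "(1 + a) * (norm (x' - xb))\<^sup>2 \<le> (1 - a) * (norm (x - xb))\<^sup>2 + N"
  shows "(norm (x' - xb'))\<^sup>2 \<le> (1 - a) * (norm (x - xb))\<^sup>2 + N + 3 / (2 * a) * (norm (xb - xb'))\<^sup>2"
proof -
  have "(norm (x' - xb'))\<^sup>2 \<le> (1 + a) * (norm (x' - xb))\<^sup>2 + (1 + 1 / a) * (norm (xb - xb'))\<^sup>2"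
    using norm_add_square_le[OF a(1), of "x' - xb" "xb - xb'"] by simp
  moreover have "(1 + 1 / a) * (norm (xb - xb'))\<^sup>2 \<le> 3 / (2 * a) * (norm (xb - xb'))\<^sup>2"
    using a by (intro mult_right_mono) (auto simp: field_simps)
  ultimately show ?thesis using step by linarith
qed

section \<open>Conditionally sub-Gaussian noise\<close>

text \<open>For a centred variable the term w disappears in the mean, leaving the exponential moment
  of the square. Up to 1 the polynomial \<open>1 + w + w\<^sup>2\<close> lies between the two sides;
  beyond 1 the square exceeds w.\<close>

lemma exp_le_add_exp_square: "exp w \<le> w + exp (w\<^sup>2)" for w :: real
proof (cases "w \<le> 1")
  case True
  have "exp w \<le> 1 + w + w\<^sup>2"
  proof (cases "0 \<le> w")
    case True
    with \<open>w \<le> 1\<close> show ?thesis by (intro exp_bound)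
  next
    case False
    define u where "u = - w"
    have u: "0 < u" using False by (simp add: u_def)
    \<comment> \<open>The claim is \<open>exp (- u) \<le> 1 - u + u\<^sup>2\<close>. It holds
      because the right-hand side times the quadratic Taylor polynomial of \<open>exp u\<close> is
      already at least 1.\<close>
    have "1 \<le> 1 + u\<^sup>2 / 2 + u ^ 3 / 2 + u ^ 4 / 2" using u by simp
    also have "\<dots> = (1 - u + u\<^sup>2) * (1 + u + u\<^sup>2 / 2)"
      by (simp add: field_simps power2_eq_square power3_eq_cube power4_eq_xxxx)
    also have "\<dots> \<le> (1 - u + u\<^sup>2) * exp u"
    proof (rule mult_left_mono)
      show "1 + u + u\<^sup>2 / 2 \<le> exp u" using u by (intro exp_lower_Taylor_quadratic) simp
      have "0 \<le> (u - 1 / 2)\<^sup>2 + 3 / 4" by (rule add_nonneg_nonneg) auto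
      then show "0 \<le> 1 - u + u\<^sup>2" by (simp add: power2_diff algebra_simps) (simp add: power2_eq_square)
    qed
    finally have "1 / exp u \<le> 1 - u + u\<^sup>2" by (simp add: divide_le_eq)
    then show ?thesis by (simp add: u_def exp_minus field_simps)
  qed
  also have "1 + w + w\<^sup>2 \<le> w + exp (w\<^sup>2)"
    using exp_ge_add_one_self[of "w\<^sup>2"] by linarith
  finally show ?thesis .
next
  case False
  then have "w * 1 \<le> w * w" by (intro mult_left_mono) auto
  then have "exp w \<le> exp (w\<^sup>2)" by (simp add: power2_eq_square)
  with False show ?thesis by linarith
qed

lemma exp_mult_le_chord:
  assumes "0 \<le> s" "s \<le> (1::real)"
  shows "exp (s * q) \<le> 1 - s + s * exp q"
  using convex_onD[OF exp_convex, of s 0 q] assms by simp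

lemma nn_integral_exp_Icc:
  assumes "0 \<le> (q::real)"
  shows "(\<integral>\<^sup>+u. ennreal (exp u) * indicator {0..q} u \<partial>lborel) = ennreal (exp q - 1)"
  using nn_integral_FTC_Icc[of exp 0 q exp] assms
  by (auto intro!: derivative_eq_intros)

lemma nn_integral_two_exp_minus:
  "(\<integral>\<^sup>+u. ennreal (2 * exp (- u)) * indicator {0..} u \<partial>lborel) = 2"
proof -
  have "((\<lambda>u::real. - 2 * exp (- u)) \<longlongrightarrow> 0) at_top" by real_asymp
  then have "(\<integral>\<^sup>+u. ennreal (2 * exp (- u)) * indicator {0..} u \<partial>lborel) = ennreal (0 - (- 2 * exp (- 0)))"
    by (intro nn_integral_FTC_atLeast) (auto intro!: derivative_eq_intros)
  then show ?thesis by simp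
qed

section \<open>Conditional bounds integrated against past-measurable weights\<close>

context sigma_finite_subalgebra
begin

lemma integrable_times_bounded:
  fixes h b :: "'a \<Rightarrow> real"
  assumes "integrable M h" "b \<in> borel_measurable M" "\<And>\<omega>. \<bar>b \<omega>\<bar> \<le> 1"
  shows "integrable M (\<lambda>\<omega>. h \<omega> * b \<omega>)"
proof (rule Bochner_Integration.integrable_bound[OF assms(1)])
  show "AE \<omega> in M. norm (h \<omega> * b \<omega>) \<le> norm (h \<omega>)"
    using assms(3) by (auto simp: abs_mult mult_left_le)
qed (use assms in auto)

text \<open>A weight measurable with respect to F passes through the conditional expectation, so the
  almost sure bound can be integrated against it.\<close>

lemma weighted_tail_le:
  fixes h :: "'a \<Rightarrow> real"
  assumes h: "integrable M h" "\<And>\<omega>. 0 \<le> h \<omega>" "h \<in> borel_measurable F"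
    and A: "A \<in> sets M" and c: "0 \<le> c"
    and AE: "AE \<omega> in M. real_cond_exp M F (indicator A) \<omega> \<le> c"
  shows "(\<integral>\<^sup>+\<omega>. ennreal (h \<omega>) * indicator A \<omega> \<partial>M) \<le> ennreal c * (\<integral>\<^sup>+\<omega>. ennreal (h \<omega>) \<partial>M)"
proof -
  have int: "integrable M (\<lambda>\<omega>. h \<omega> * indicator A \<omega>)"
    by (rule integrable_times_bounded[OF h(1)]) (use A in \<open>auto simp: indicator_def\<close>)
  note I = real_cond_exp_intg_fpos[OF int h(2,3)]
  have "(\<integral>\<omega>. h \<omega> * indicator A \<omega> \<partial>M) = (\<integral>\<omega>. h \<omega> * real_cond_exp M F (indicator A) \<omega> \<partial>M)"
    using I(2) A by simp
  also have "\<dots> \<le> (\<integral>\<omega>. h \<omega> * c \<partial>M)"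
    using AE h A I(1) by (intro integral_mono_AE) (auto intro!: mult_left_mono)
  finally have "(\<integral>\<omega>. h \<omega> * indicator A \<omega> \<partial>M) \<le> c * (\<integral>\<omega>. h \<omega> \<partial>M)" by (simp add: mult.commute)
  then have "ennreal (\<integral>\<omega>. h \<omega> * indicator A \<omega> \<partial>M) \<le> ennreal c * ennreal (\<integral>\<omega>. h \<omega> \<partial>M)"
    using c h(2) by (simp add: ennreal_mult[symmetric] integral_nonneg ennreal_leI)
  moreover have "ennreal (\<integral>\<omega>. h \<omega> * indicator A \<omega> \<partial>M) = (\<integral>\<^sup>+\<omega>. ennreal (h \<omega> * indicator A \<omega>) \<partial>M)"
    using int h(2) by (intro nn_integral_eq_integral[symmetric]) auto
  moreover have "ennreal (h \<omega> * indicator A \<omega>) = ennreal (h \<omega>) * indicator A \<omega>" for \<omega>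
    by (simp add: indicator_def)
  ultimately show ?thesis
    using h(1,2) by (simp add: nn_integral_eq_integral)
qed

text \<open>Layer cake: \<open>exp q = 1 + \<integral> exp u du\<close> over \<open>0 \<le> u \<le> q\<close>, and the tail at level \<open>u\<close> is
  \<open>2 exp (- 2 u)\<close>.\<close>

lemma weighted_exp_norm_square_le:
  fixes h :: "'a \<Rightarrow> real" and z :: "'a \<Rightarrow> 'b::euclidean_space"
  assumes h: "\<And>\<omega>. 0 \<le> h \<omega>" "h \<in> borel_measurable F"
    and z[measurable]: "z \<in> borel_measurable M" and \<sigma>: "0 < \<sigma>"
    and tail: "\<And>\<tau>. 0 < \<tau> \<Longrightarrow> AE \<omega> in M. real_cond_exp M F
      (indicator {\<omega> \<in> space M. \<tau> \<le> norm (z \<omega>)}) \<omega> \<le> 2 * exp (- 2 * \<tau>\<^sup>2 / \<sigma>\<^sup>2)"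
  shows "(\<integral>\<^sup>+\<omega>. ennreal (h \<omega> * exp ((norm (z \<omega>))\<^sup>2 / \<sigma>\<^sup>2)) \<partial>M) \<le> 3 * (\<integral>\<^sup>+\<omega>. ennreal (h \<omega>) \<partial>M)"
proof (cases "(\<integral>\<^sup>+\<omega>. ennreal (h \<omega>) \<partial>M) = \<infinity>")
  case False
  have [measurable]: "h \<in> borel_measurable M" using measurable_from_subalg[OF subalg h(2)] .
  have h_int: "integrable M h"
    using False h(1) by (intro integrableI_nonneg) (auto simp: less_top[symmetric])
  interpret L: sigma_finite_measure "lborel :: real measure" by (rule sigma_finite_lborel)
  interpret P: pair_sigma_finite "lborel :: real measure" M by unfold_locales
  define q where "q \<omega> = (norm (z \<omega>))\<^sup>2 / \<sigma>\<^sup>2" for \<omega>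
  have q_meas[measurable]: "q \<in> borel_measurable M" unfolding q_def by measurable
  have q_nn: "0 \<le> q \<omega>" for \<omega> by (simp add: q_def)
  let ?H = "\<integral>\<^sup>+\<omega>. ennreal (h \<omega>) \<partial>M"
  let ?A = "\<lambda>u. {\<omega> \<in> space M. u \<le> q \<omega>}"
  have level: "(\<integral>\<^sup>+\<omega>. ennreal (h \<omega>) * indicator (?A u) \<omega> \<partial>M) \<le> ennreal (2 * exp (- 2 * u)) * ?H"
    if u: "0 \<le> u" for u
  \<comment> \<open>The tail hypothesis covers positive levels; at level 0 the bound has factor 2
    and is trivial.\<close>
  proof (cases "u = 0")
    case True
    have "(\<integral>\<^sup>+\<omega>. ennreal (h \<omega>) * indicator (?A u) \<omega> \<partial>M) \<le> 1 * ?H"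
      by (auto intro!: nn_integral_mono simp: indicator_def)
    also have "\<dots> \<le> ennreal (2 * exp (- 2 * u)) * ?H" using True by (intro mult_right_mono) auto
    finally show ?thesis .
  next
    case False
    define \<tau> where "\<tau> = \<sigma> * sqrt u"
    have \<tau>: "0 < \<tau>" "\<tau>\<^sup>2 = \<sigma>\<^sup>2 * u" using False u \<sigma> by (auto simp: \<tau>_def power_mult_distrib)
    have "u \<le> q \<omega> \<longleftrightarrow> \<tau> \<le> norm (z \<omega>)" for \<omega>
    proof -
      have "u \<le> q \<omega> \<longleftrightarrow> \<tau>\<^sup>2 \<le> (norm (z \<omega>))\<^sup>2" using \<sigma> by (simp add: \<tau>(2) q_def le_divide_eq mult.commute)
      also have "\<dots> \<longleftrightarrow> \<tau> \<le> norm (z \<omega>)" using \<tau>(1) by (simp add: power2_le_iff_abs_le)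
      finally show ?thesis .
    qed
    then have A: "?A u = {\<omega> \<in> space M. \<tau> \<le> norm (z \<omega>)}" by simp
    have "- 2 * \<tau>\<^sup>2 / \<sigma>\<^sup>2 = - 2 * u" using \<sigma> by (simp add: \<tau>(2))
    with tail[OF \<tau>(1)] have "AE \<omega> in M. real_cond_exp M F (indicator (?A u)) \<omega> \<le> 2 * exp (- 2 * u)"
      unfolding A by simp
    then show ?thesis by (intro weighted_tail_le h_int h) auto
  qed
  have "(\<integral>\<^sup>+\<omega>. ennreal (h \<omega> * exp (q \<omega>)) \<partial>M)
      = (\<integral>\<^sup>+\<omega>. ennreal (h \<omega>) + ennreal (h \<omega>) * ennreal (exp (q \<omega>) - 1) \<partial>M)"
  proof (rule nn_integral_cong)
    fix \<omega>
    have "ennreal (h \<omega>) + ennreal (h \<omega>) * ennreal (exp (q \<omega>) - 1) = ennreal (h \<omega> + h \<omega> * (exp (q \<omega>) - 1))"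
      using h(1)[of \<omega>] q_nn[of \<omega>] by (simp add: ennreal_mult ennreal_plus)
    then show "ennreal (h \<omega> * exp (q \<omega>)) = ennreal (h \<omega>) + ennreal (h \<omega>) * ennreal (exp (q \<omega>) - 1)"
      by (simp add: algebra_simps)
  qed
  also have "\<dots> = ?H + (\<integral>\<^sup>+\<omega>. ennreal (h \<omega>) * ennreal (exp (q \<omega>) - 1) \<partial>M)"
    by (intro nn_integral_add) auto
  also have "(\<integral>\<^sup>+\<omega>. ennreal (h \<omega>) * ennreal (exp (q \<omega>) - 1) \<partial>M)
      = (\<integral>\<^sup>+\<omega>. \<integral>\<^sup>+u. ennreal (h \<omega>) * (ennreal (exp u) * indicator {0..q \<omega>} u) \<partial>lborel \<partial>M)"
    by (simp add: nn_integral_cmult nn_integral_exp_Icc q_nn)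
  also have "\<dots> = (\<integral>\<^sup>+\<omega>. \<integral>\<^sup>+u. ennreal (exp u) * indicator {0..} u * (ennreal (h \<omega>) * indicator (?A u) \<omega>)
      \<partial>lborel \<partial>M)"
    by (intro nn_integral_cong) (auto simp: indicator_def ac_simps)
  also have "\<dots> = (\<integral>\<^sup>+u. \<integral>\<^sup>+\<omega>. ennreal (exp u) * indicator {0..} u * (ennreal (h \<omega>) * indicator (?A u) \<omega>)
      \<partial>M \<partial>lborel)"
    by (rule P.Fubini') measurable
  also have "\<dots> \<le> (\<integral>\<^sup>+u. ?H * (ennreal (2 * exp (- u)) * indicator {0..} u) \<partial>lborel)"
  proof (rule nn_integral_mono)
    fix u :: real
    have "(\<integral>\<^sup>+\<omega>. ennreal (exp u) * indicator {0..} u * (ennreal (h \<omega>) * indicator (?A u) \<omega>) \<partial>M)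
        = ennreal (exp u) * indicator {0..} u * (\<integral>\<^sup>+\<omega>. ennreal (h \<omega>) * indicator (?A u) \<omega> \<partial>M)"
      by (rule nn_integral_cmult) measurable
    also have "\<dots> \<le> ennreal (exp u) * indicator {0..} u * (ennreal (2 * exp (- 2 * u)) * ?H)"
      using level[of u] by (cases "0 \<le> u") (auto intro!: mult_left_mono)
    also have "\<dots> = ?H * (ennreal (exp u * (2 * exp (- 2 * u))) * indicator {0..} u)"
      by (simp add: ennreal_mult ac_simps)
    also have "exp u * (2 * exp (- 2 * u)) = 2 * exp (- u)" by (simp add: exp_add[symmetric])
    finally show "(\<integral>\<^sup>+\<omega>. ennreal (exp u) * indicator {0..} u * (ennreal (h \<omega>) * indicator (?A u) \<omega>) \<partial>M)
      \<le> ?H * (ennreal (2 * exp (- u)) * indicator {0..} u)" .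
  qed
  \<comment> \<open>The tail integral contributes 2 and the constant of the layer cake 1: hence the
    factor 3.\<close>
  also have "\<dots> = ?H * 2"
    by (subst nn_integral_cmult) (simp_all add: nn_integral_two_exp_minus)
  also have "?H + ?H * 2 = (1 + 2) * ?H" by (simp only: distrib_right mult_1 mult.commute)
  finally show ?thesis by (simp add: q_def)
qed (simp add: ennreal_mult_top)

text \<open>The chord of exp interpolates between the moments 1 and 3, giving
  \<open>1 + 2 * s \<le> exp (2 * s)\<close>. The constant must tend to 1 with s because it is paid
  at every iteration.\<close>

lemma weighted_exp_norm_square_scaled_le:
  fixes h :: "'a \<Rightarrow> real" and z :: "'a \<Rightarrow> 'b::euclidean_space"
  assumes h: "\<And>\<omega>. 0 \<le> h \<omega>" "h \<in> borel_measurable F"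
    and z[measurable]: "z \<in> borel_measurable M" and \<sigma>: "0 < \<sigma>"
    and tail: "\<And>\<tau>. 0 < \<tau> \<Longrightarrow> AE \<omega> in M. real_cond_exp M F
      (indicator {\<omega> \<in> space M. \<tau> \<le> norm (z \<omega>)}) \<omega> \<le> 2 * exp (- 2 * \<tau>\<^sup>2 / \<sigma>\<^sup>2)"
    and s: "0 \<le> s" "s \<le> 1"
  shows "(\<integral>\<^sup>+\<omega>. ennreal (h \<omega> * exp (s * ((norm (z \<omega>))\<^sup>2 / \<sigma>\<^sup>2))) \<partial>M)
    \<le> ennreal (exp (2 * s)) * (\<integral>\<^sup>+\<omega>. ennreal (h \<omega>) \<partial>M)"
proof -
  have [measurable]: "h \<in> borel_measurable M" using measurable_from_subalg[OF subalg h(2)] .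
  define q where "q \<omega> = (norm (z \<omega>))\<^sup>2 / \<sigma>\<^sup>2" for \<omega>
  have [measurable]: "q \<in> borel_measurable M" unfolding q_def by measurable
  let ?H = "\<integral>\<^sup>+\<omega>. ennreal (h \<omega>) \<partial>M"
  have "(\<integral>\<^sup>+\<omega>. ennreal (h \<omega> * exp (s * q \<omega>)) \<partial>M)
      \<le> (\<integral>\<^sup>+\<omega>. ennreal (1 - s) * ennreal (h \<omega>) + ennreal s * ennreal (h \<omega> * exp (q \<omega>)) \<partial>M)"
  proof (rule nn_integral_mono)
    fix \<omega>
    have "h \<omega> * exp (s * q \<omega>) \<le> h \<omega> * (1 - s + s * exp (q \<omega>))"
      using h(1) s by (intro mult_left_mono exp_mult_le_chord)
    also have "\<dots> = (1 - s) * h \<omega> + s * (h \<omega> * exp (q \<omega>))" by (simp add: algebra_simps)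
    finally have "ennreal (h \<omega> * exp (s * q \<omega>)) \<le> ennreal ((1 - s) * h \<omega> + s * (h \<omega> * exp (q \<omega>)))"
      by (rule ennreal_leI)
    also have "\<dots> = ennreal (1 - s) * ennreal (h \<omega>) + ennreal s * ennreal (h \<omega> * exp (q \<omega>))"
      using h(1)[of \<omega>] s by (simp add: ennreal_plus ennreal_mult)
    finally show "ennreal (h \<omega> * exp (s * q \<omega>))
        \<le> ennreal (1 - s) * ennreal (h \<omega>) + ennreal s * ennreal (h \<omega> * exp (q \<omega>))" .
  qed
  also have "\<dots> = ennreal (1 - s) * ?H + ennreal s * (\<integral>\<^sup>+\<omega>. ennreal (h \<omega> * exp (q \<omega>)) \<partial>M)"
    by (simp add: nn_integral_add nn_integral_cmult)
  also have "\<dots> \<le> ennreal (1 - s) * ?H + ennreal s * (3 * ?H)"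
    unfolding q_def
    by (intro add_left_mono mult_left_mono weighted_exp_norm_square_le h z \<sigma> tail) auto
  also have "\<dots> = (ennreal (1 - s) + ennreal s * ennreal 3) * ?H"
    by (simp add: distrib_right mult.assoc)
  also have "ennreal (1 - s) + ennreal s * ennreal 3 = ennreal (1 - s + s * 3)"
    using s by (simp add: ennreal_mult[symmetric] ennreal_plus[symmetric] del: ennreal_plus ennreal_numeral)
  also have "ennreal (1 - s + s * 3) * ?H \<le> ennreal (exp (2 * s)) * ?H"
  proof (intro mult_right_mono ennreal_leI)
    show "1 - s + s * 3 \<le> exp (2 * s)" using exp_ge_add_one_self[of "2 * s"] by linarith
  qed simp
  finally show ?thesis by (simp add: q_def)
qed

text \<open>Centred noise is orthogonal to vectors known from the past, coordinate by coordinate.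
  The dominating k secures integrability of each coordinate product, without which the past factor
  could not be pulled out.\<close>

lemma weighted_mean_zero:
  fixes v z :: "'a \<Rightarrow> 'b::euclidean_space"
  assumes v: "v \<in> borel_measurable F" and z[measurable]: "z \<in> borel_measurable M"
    and mean: "\<And>b. b \<in> Basis \<Longrightarrow> AE \<omega> in M. real_cond_exp M F (\<lambda>\<omega>. z \<omega> \<bullet> b) \<omega> = 0"
    and k: "integrable M k" "\<And>\<omega>. norm (v \<omega>) * norm (z \<omega>) \<le> k \<omega>"
  shows "integrable M (\<lambda>\<omega>. v \<omega> \<bullet> z \<omega>)" and "(\<integral>\<omega>. v \<omega> \<bullet> z \<omega> \<partial>M) = 0"
proof -
  have [measurable]: "v \<in> borel_measurable M" using measurable_from_subalg[OF subalg v] .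
  have int: "integrable M (\<lambda>\<omega>. (v \<omega> \<bullet> b) * (z \<omega> \<bullet> b))" if b: "b \<in> Basis" for b
  proof (rule Bochner_Integration.integrable_bound[OF k(1)])
    have "norm ((v \<omega> \<bullet> b) * (z \<omega> \<bullet> b)) \<le> norm (k \<omega>)" for \<omega>
    proof -
      have "norm ((v \<omega> \<bullet> b) * (z \<omega> \<bullet> b)) \<le> norm (v \<omega>) * norm (z \<omega>)"
        using b by (auto simp: abs_mult intro!: mult_mono Basis_le_norm)
      with k(2)[of \<omega>] show ?thesis by simp
    qed
    then show "AE \<omega> in M. norm ((v \<omega> \<bullet> b) * (z \<omega> \<bullet> b)) \<le> norm (k \<omega>)" by simp
  qed measurable
  have 0: "(\<integral>\<omega>. (v \<omega> \<bullet> b) * (z \<omega> \<bullet> b) \<partial>M) = 0" if b: "b \<in> Basis" for b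
  proof -
    have vb: "(\<lambda>\<omega>. v \<omega> \<bullet> b) \<in> borel_measurable F" using v by measurable
    have "(\<integral>\<omega>. (v \<omega> \<bullet> b) * (z \<omega> \<bullet> b) \<partial>M)
        = (\<integral>\<omega>. (v \<omega> \<bullet> b) * real_cond_exp M F (\<lambda>\<omega>. z \<omega> \<bullet> b) \<omega> \<partial>M)"
      by (rule real_cond_exp_intg(2)[symmetric, OF int[OF b] vb]) measurable
    also have "\<dots> = (\<integral>\<omega>. 0 \<partial>M)"
      using mean[OF b] by (intro integral_cong_AE) (auto intro: measurable_from_subalg[OF subalg])
    finally show ?thesis by simp
  qed
  show "integrable M (\<lambda>\<omega>. v \<omega> \<bullet> z \<omega>)"
    unfolding euclidean_inner[of "v _" "z _"] by (intro Bochner_Integration.integrable_sum int)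
  show "(\<integral>\<omega>. v \<omega> \<bullet> z \<omega> \<partial>M) = 0"
    unfolding euclidean_inner[of "v _" "z _"]
    by (subst Bochner_Integration.integral_sum) (auto intro: int simp: 0)
qed

text \<open>For short v, centring removes the linear term and \<open>exp_le_add_exp_square\<close>
  leaves a bound close to 1. For long v centring brings nothing essential, and Young's inequality is
  enough.\<close>

lemma weighted_exp_inner_le:
  fixes h :: "'a \<Rightarrow> real" and v z :: "'a \<Rightarrow> 'b::euclidean_space"
  assumes h: "\<And>\<omega>. 0 \<le> h \<omega>" "h \<in> borel_measurable F"
    and v: "v \<in> borel_measurable F"
    and z[measurable]: "z \<in> borel_measurable M" and \<sigma>: "0 < \<sigma>"
    and mean: "\<And>b. b \<in> Basis \<Longrightarrow> AE \<omega> in M. real_cond_exp M F (\<lambda>\<omega>. z \<omega> \<bullet> b) \<omega> = 0"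
    and tail: "\<And>\<tau>. 0 < \<tau> \<Longrightarrow> AE \<omega> in M. real_cond_exp M F
      (indicator {\<omega> \<in> space M. \<tau> \<le> norm (z \<omega>)}) \<omega> \<le> 2 * exp (- 2 * \<tau>\<^sup>2 / \<sigma>\<^sup>2)"
  shows "(\<integral>\<^sup>+\<omega>. ennreal (h \<omega> * exp (v \<omega> \<bullet> z \<omega>)) \<partial>M)
    \<le> (\<integral>\<^sup>+\<omega>. ennreal (h \<omega> * exp (9 / 4 * (\<sigma> * norm (v \<omega>))\<^sup>2)) \<partial>M)"
proof (cases "(\<integral>\<^sup>+\<omega>. ennreal (h \<omega> * exp (9 / 4 * (\<sigma> * norm (v \<omega>))\<^sup>2)) \<partial>M) = \<infinity>")
  case False
  note h_meas[measurable] = measurable_from_subalg[OF subalg h(2)]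
  note v_meas[measurable] = measurable_from_subalg[OF subalg v]
  define s where "s \<omega> = (\<sigma> * norm (v \<omega>))\<^sup>2" for \<omega>
  define q where "q \<omega> = (norm (z \<omega>))\<^sup>2 / \<sigma>\<^sup>2" for \<omega>
  define k where "k \<omega> = h \<omega> * exp (9 / 4 * s \<omega>)" for \<omega>
  \<comment> \<open>\<open>\<alpha>\<close> and \<open>\<beta>\<close> are the coefficients of 1 and
    \<open>exp q\<close> in the pointwise bound \<open>pt\<close>: the chord weights for
    \<open>s \<le> 1\<close>, otherwise those of \<open>v \<bullet> z \<le> s / 4 + q\<close>. The
    linear term survives only for \<open>s \<le> 1\<close>, which \<open>v'\<close> encodes.\<close>
  define \<alpha> where "\<alpha> \<omega> = (if s \<omega> \<le> 1 then 1 - s \<omega> else 0)" for \<omega>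
  define \<beta> where "\<beta> \<omega> = (if s \<omega> \<le> 1 then s \<omega> else exp (s \<omega> / 4))" for \<omega>
  define v' where "v' \<omega> = (if s \<omega> \<le> 1 then h \<omega> *\<^sub>R v \<omega> else 0)" for \<omega>
  have s_F[measurable]: "s \<in> borel_measurable F" using v unfolding s_def by measurable
  have \<beta>_F: "\<beta> \<in> borel_measurable F" unfolding \<beta>_def by measurable
  have v'_F: "v' \<in> borel_measurable F" unfolding v'_def using v h by measurable
  have s_M[measurable]: "s \<in> borel_measurable M" unfolding s_def by measurable
  have [measurable]: "q \<in> borel_measurable M" unfolding q_def by measurable
  have [measurable]: "\<alpha> \<in> borel_measurable M" unfolding \<alpha>_def by measurable
  have [measurable]: "\<beta> \<in> borel_measurable M" unfolding \<beta>_def by measurable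
  have s_nn: "0 \<le> s \<omega>" for \<omega> by (simp add: s_def)
  have \<alpha>: "0 \<le> \<alpha> \<omega>" for \<omega> by (simp add: \<alpha>_def)
  have \<beta>: "0 \<le> \<beta> \<omega>" for \<omega> by (simp add: \<beta>_def s_nn)
  \<comment> \<open>The 3 is the moment of \<open>exp q\<close>. Short v gives
    \<open>1 + 2 * s\<close>; long v gives \<open>3 * exp (s / 4)\<close> with
    \<open>3 \<le> exp (2 * s)\<close>. The constant arises as
    \<open>9 / 4 = 2 + 1 / 4\<close>.\<close>
  have \<alpha>\<beta>: "\<alpha> \<omega> + 3 * \<beta> \<omega> \<le> exp (9 / 4 * s \<omega>)" for \<omega>
  proof (cases "s \<omega> \<le> 1")
    case True
    have "1 + 9 / 4 * s \<omega> \<le> exp (9 / 4 * s \<omega>)" by (rule exp_ge_add_one_self)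
    with True s_nn[of \<omega>] show ?thesis by (simp only: \<alpha>_def \<beta>_def if_True)
  next
    case s: False
    have "3 * exp (s \<omega> / 4) \<le> exp (2 * s \<omega>) * exp (s \<omega> / 4)"
    proof (rule mult_right_mono)
      show "3 \<le> exp (2 * s \<omega>)" using s exp_ge_add_one_self[of "2 * s \<omega>"] by linarith
    qed simp
    also have "\<dots> = exp (9 / 4 * s \<omega>)" by (simp add: exp_add[symmetric])
    finally show ?thesis using s by (simp add: \<alpha>_def \<beta>_def)
  qed
  have prod: "norm (v \<omega>) * norm (z \<omega>) = sqrt (s \<omega>) * sqrt (q \<omega>)" for \<omega>
    using \<sigma> by (simp add: s_def q_def real_sqrt_divide)
  have pt: "h \<omega> * exp (v \<omega> \<bullet> z \<omega>) \<le> v' \<omega> \<bullet> z \<omega> + h \<omega> * \<alpha> \<omega> + h \<omega> * \<beta> \<omega> * exp (q \<omega>)" for \<omega>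
  proof -
    have CS: "\<bar>v \<omega> \<bullet> z \<omega>\<bar> \<le> sqrt (s \<omega>) * sqrt (q \<omega>)"
      using Cauchy_Schwarz_ineq2 prod by metis
    have q0: "0 \<le> q \<omega>" by (simp add: q_def)
    show ?thesis
    proof (cases "s \<omega> \<le> 1")
      case True
      have "(v \<omega> \<bullet> z \<omega>)\<^sup>2 \<le> (sqrt (s \<omega>) * sqrt (q \<omega>))\<^sup>2"
        using power_mono[OF CS, of 2] by simp
      then have "(v \<omega> \<bullet> z \<omega>)\<^sup>2 \<le> s \<omega> * q \<omega>" using s_nn[of \<omega>] q0 by (simp add: power_mult_distrib)
      then have "exp ((v \<omega> \<bullet> z \<omega>)\<^sup>2) \<le> exp (s \<omega> * q \<omega>)" by simp
      also have "\<dots> \<le> 1 - s \<omega> + s \<omega> * exp (q \<omega>)" using s_nn True by (rule exp_mult_le_chord)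
      finally have "exp (v \<omega> \<bullet> z \<omega>) \<le> v \<omega> \<bullet> z \<omega> + (1 - s \<omega> + s \<omega> * exp (q \<omega>))"
        using exp_le_add_exp_square[of "v \<omega> \<bullet> z \<omega>"] by linarith
      then have "h \<omega> * exp (v \<omega> \<bullet> z \<omega>) \<le> h \<omega> * (v \<omega> \<bullet> z \<omega> + (1 - s \<omega> + s \<omega> * exp (q \<omega>)))"
        using h(1) by (rule mult_left_mono)
      also have "\<dots> = v' \<omega> \<bullet> z \<omega> + h \<omega> * \<alpha> \<omega> + h \<omega> * \<beta> \<omega> * exp (q \<omega>)"
        using True by (simp add: \<alpha>_def \<beta>_def v'_def algebra_simps)
      finally show ?thesis .
    next
      case s: False
      have "2 * (sqrt (s \<omega>) / 2) * sqrt (q \<omega>) \<le> (sqrt (s \<omega>) / 2)\<^sup>2 + (sqrt (q \<omega>))\<^sup>2"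
        by (rule sum_squares_bound)
      then have "v \<omega> \<bullet> z \<omega> \<le> s \<omega> / 4 + q \<omega>"
        using CS s_nn[of \<omega>] q0 by (simp add: power_divide)
      then have "exp (v \<omega> \<bullet> z \<omega>) \<le> exp (s \<omega> / 4) * exp (q \<omega>)" by (simp add: exp_add[symmetric])
      with h(1)[of \<omega>] s show ?thesis
        by (simp add: \<alpha>_def \<beta>_def v'_def mult.assoc mult_left_mono)
    qed
  qed
  have k_nn: "0 \<le> k \<omega>" for \<omega> using h(1) by (simp add: k_def)
  \<comment> \<open>Finiteness of the right-hand side is the sole source of integrability: k
    dominates h and its products with \<open>\<alpha>\<close> and \<open>\<beta>\<close>.\<close>
  have "k \<in> borel_measurable M" unfolding k_def by measurable
  then have k: "integrable M k"
    using False k_nn by (intro integrableI_nonneg) (auto simp: k_def s_def less_top[symmetric])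
  have le_k: "h \<omega> * (\<alpha> \<omega> + 3 * \<beta> \<omega>) \<le> k \<omega>" for \<omega>
    unfolding k_def using \<alpha>\<beta> h(1) by (intro mult_left_mono)
  have int_k: "integrable M (\<lambda>\<omega>. h \<omega> * c \<omega>)"
    if "c \<in> borel_measurable M" "\<And>\<omega>. 0 \<le> c \<omega>" "\<And>\<omega>. c \<omega> \<le> exp (9 / 4 * s \<omega>)" for c
  proof (rule Bochner_Integration.integrable_bound[OF k])
    show "AE \<omega> in M. norm (h \<omega> * c \<omega>) \<le> norm (k \<omega>)"
      using that(2,3) h(1) by (auto simp: k_def abs_mult intro!: mult_left_mono)
  qed (use that in measurable)
  have "\<alpha> \<omega> \<le> exp (9 / 4 * s \<omega>)" for \<omega> using \<beta>[of \<omega>] \<alpha>\<beta>[of \<omega>] by linarith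
  then have int_\<alpha>: "integrable M (\<lambda>\<omega>. h \<omega> * \<alpha> \<omega>)" using \<alpha> by (intro int_k) auto
  have "\<beta> \<omega> \<le> exp (9 / 4 * s \<omega>)" for \<omega> using \<alpha>[of \<omega>] \<beta>[of \<omega>] \<alpha>\<beta>[of \<omega>] by linarith
  then have int_\<beta>: "integrable M (\<lambda>\<omega>. h \<omega> * \<beta> \<omega>)" using \<beta> by (intro int_k) auto
  have "integrable M (\<lambda>\<omega>. h \<omega> * 1)" using s_nn by (intro int_k) auto
  then have int_h: "integrable M h" by simp
  have int_exp: "integrable M (\<lambda>\<omega>. g \<omega> * exp (q \<omega>))"
    and le_exp: "(\<integral>\<omega>. g \<omega> * exp (q \<omega>) \<partial>M) \<le> 3 * (\<integral>\<omega>. g \<omega> \<partial>M)"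
    if g: "integrable M g" "\<And>\<omega>. 0 \<le> g \<omega>" "g \<in> borel_measurable F" for g
  proof -
    have *: "(\<integral>\<^sup>+\<omega>. ennreal (g \<omega> * exp (q \<omega>)) \<partial>M) \<le> 3 * (\<integral>\<^sup>+\<omega>. ennreal (g \<omega>) \<partial>M)"
      unfolding q_def by (rule weighted_exp_norm_square_le) (use g z \<sigma> tail in auto)
    also have "3 * (\<integral>\<^sup>+\<omega>. ennreal (g \<omega>) \<partial>M) = ennreal (3 * (\<integral>\<omega>. g \<omega> \<partial>M))"
      using g by (simp add: nn_integral_eq_integral ennreal_mult integral_nonneg)
    finally have 1: "(\<integral>\<^sup>+\<omega>. ennreal (g \<omega> * exp (q \<omega>)) \<partial>M) \<le> ennreal (3 * (\<integral>\<omega>. g \<omega> \<partial>M))" .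
    show int: "integrable M (\<lambda>\<omega>. g \<omega> * exp (q \<omega>))"
      using 1 g by (intro integrableI_nonneg) (auto intro: le_less_trans)
    have "ennreal (\<integral>\<omega>. g \<omega> * exp (q \<omega>) \<partial>M) \<le> ennreal (3 * (\<integral>\<omega>. g \<omega> \<partial>M))"
      using 1 int g by (simp add: nn_integral_eq_integral)
    then show "(\<integral>\<omega>. g \<omega> * exp (q \<omega>) \<partial>M) \<le> 3 * (\<integral>\<omega>. g \<omega> \<partial>M)"
      using g by (simp add: ennreal_le_iff integral_nonneg)
  qed
  \<comment> \<open>Where \<open>v'\<close> can be nonzero, \<open>s \<le> 1\<close> bounds the
    product of norms by \<open>sqrt q\<close>, hence by \<open>exp q\<close>. This is the dominator
    for \<open>weighted_mean_zero\<close>.\<close>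
  have dom: "norm (v' \<omega>) * norm (z \<omega>) \<le> h \<omega> * exp (q \<omega>)" for \<omega>
  proof (cases "s \<omega> \<le> 1")
    case True
    have "sqrt (s \<omega>) * sqrt (q \<omega>) \<le> 1 * sqrt (q \<omega>)"
      using True by (intro mult_right_mono) (auto simp: q_def)
    also have "\<dots> \<le> 1 + q \<omega>"
    proof -
      have "0 \<le> q \<omega>" by (simp add: q_def)
      then show ?thesis using sum_squares_bound[of 1 "sqrt (q \<omega>)"] by simp
    qed
    also have "\<dots> \<le> exp (q \<omega>)" by (rule exp_ge_add_one_self)
    finally have "norm (v \<omega>) * norm (z \<omega>) \<le> exp (q \<omega>)" by (simp add: prod)
    then have "h \<omega> * (norm (v \<omega>) * norm (z \<omega>)) \<le> h \<omega> * exp (q \<omega>)"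
      using h(1) by (rule mult_left_mono)
    with True h(1)[of \<omega>] show ?thesis by (simp add: v'_def mult.assoc)
  qed (use h(1) in \<open>simp add: v'_def\<close>)
  note int_v = weighted_mean_zero[OF v'_F z mean int_exp[OF int_h h] dom]
  have h\<beta>_F: "(\<lambda>\<omega>. h \<omega> * \<beta> \<omega>) \<in> borel_measurable F" using h(2) \<beta>_F by measurable
  have h\<beta>_nn: "0 \<le> h \<omega> * \<beta> \<omega>" for \<omega> using h(1) \<beta> by simp
  let ?U = "\<lambda>\<omega>. v' \<omega> \<bullet> z \<omega> + h \<omega> * \<alpha> \<omega> + h \<omega> * \<beta> \<omega> * exp (q \<omega>)"
  note int = int_v(1) int_\<alpha> int_exp[OF int_\<beta> h\<beta>_nn h\<beta>_F]
  have U_nn: "0 \<le> ?U \<omega>" for \<omega> by (rule order_trans[OF _ pt]) (use h(1) in simp)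
  have "(\<integral>\<^sup>+\<omega>. ennreal (h \<omega> * exp (v \<omega> \<bullet> z \<omega>)) \<partial>M) \<le> (\<integral>\<^sup>+\<omega>. ennreal (?U \<omega>) \<partial>M)"
    by (intro nn_integral_mono ennreal_leI pt)
  also have "\<dots> = ennreal (\<integral>\<omega>. ?U \<omega> \<partial>M)"
    using int U_nn by (intro nn_integral_eq_integral Bochner_Integration.integrable_add) auto
  also have "(\<integral>\<omega>. ?U \<omega> \<partial>M) = (\<integral>\<omega>. h \<omega> * \<alpha> \<omega> \<partial>M) + (\<integral>\<omega>. h \<omega> * \<beta> \<omega> * exp (q \<omega>) \<partial>M)"
    using int int_v(2) by simp
  also have "\<dots> \<le> (\<integral>\<omega>. h \<omega> * \<alpha> \<omega> \<partial>M) + 3 * (\<integral>\<omega>. h \<omega> * \<beta> \<omega> \<partial>M)"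
    using le_exp[OF int_\<beta> h\<beta>_nn h\<beta>_F] by simp
  also have "\<dots> = (\<integral>\<omega>. h \<omega> * (\<alpha> \<omega> + 3 * \<beta> \<omega>) \<partial>M)"
    using int_\<alpha> int_\<beta> by (simp add: distrib_left mult.left_commute[of _ 3])
  also have "\<dots> \<le> (\<integral>\<omega>. k \<omega> \<partial>M)"
  proof (rule integral_mono[OF _ k le_k])
    show "integrable M (\<lambda>\<omega>. h \<omega> * (\<alpha> \<omega> + 3 * \<beta> \<omega>))"
      using int_\<alpha> int_\<beta> by (simp add: distrib_left mult.left_commute[of _ 3])
  qed
  also have "ennreal (\<integral>\<omega>. k \<omega> \<partial>M) = (\<integral>\<^sup>+\<omega>. ennreal (k \<omega>) \<partial>M)"
    using k k_nn by (simp add: nn_integral_eq_integral)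
  finally show ?thesis by (simp add: k_def s_def ennreal_leI)
qed simp

end

section \<open>Exponential moments of the tracking error\<close>

lemma exp_weighted_mean_le:
  "exp (p / 4 + q / 4 + r / 2) \<le> exp p / 4 + exp q / 4 + exp r / 2" for p q r :: real
proof -
  have half: "exp ((u + v) / 2) \<le> exp u / 2 + exp v / 2" for u v :: real
    using convex_onD[OF exp_convex, of "1 / 2" u v] by (simp add: field_simps)
  have "exp (p / 4 + q / 4 + r / 2) = exp (((p + q) / 2 + r) / 2)" by (simp add: field_simps)
  also have "\<dots> \<le> exp ((p + q) / 2) / 2 + exp r / 2" by (rule half)
  also have "\<dots> \<le> (exp p / 2 + exp q / 2) / 2 + exp r / 2" using half[of p q] by simp
  finally show ?thesis by (simp add: add_divide_distrib)
qed

text \<open>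
  Noise and drift may be dependent, so the conditional moment generating function of their sum is
  split by Hoelder with exponents 4, 4, 2; here this is done pointwise, by convexity of \<open>exp\<close> after
  centring each term at its bound.
\<close>

lemma (in sigma_finite_subalgebra) exp_moment_step:
  fixes y z :: "'a \<Rightarrow> 'b::euclidean_space" and d V :: "'a \<Rightarrow> real"
  assumes y: "y \<in> borel_measurable F" and z[measurable]: "z \<in> borel_measurable M"
    and d[measurable]: "d \<in> borel_measurable M"
    and \<sigma>: "0 < \<sigma>" and \<Delta>: "0 < \<Delta>" and a: "0 < a" "a \<le> 1 / 2" and \<eta>: "0 < \<eta>"
    and \<kappa>: "0 < \<kappa>" "72 * \<kappa> * \<eta>\<^sup>2 * \<sigma>\<^sup>2 \<le> a" "3 * \<kappa> * \<Delta>\<^sup>2 \<le> a"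
    and mean: "\<And>b. b \<in> Basis \<Longrightarrow> AE \<omega> in M. real_cond_exp M F (\<lambda>\<omega>. z \<omega> \<bullet> b) \<omega> = 0"
    and tail: "\<And>\<tau>. 0 < \<tau> \<Longrightarrow> AE \<omega> in M. real_cond_exp M F
      (indicator {\<omega> \<in> space M. \<tau> \<le> norm (z \<omega>)}) \<omega> \<le> 2 * exp (- 2 * \<tau>\<^sup>2 / \<sigma>\<^sup>2)"
    and drift: "\<And>s. 0 \<le> s \<Longrightarrow> s \<le> 1 / \<Delta>\<^sup>2 \<Longrightarrow> AE \<omega> in M.
      nn_cond_exp M F (\<lambda>\<omega>. ennreal (exp (s * (d \<omega>)\<^sup>2))) \<omega> \<le> ennreal (exp (s * \<Delta>\<^sup>2))"
    and V: "\<And>\<omega>. \<omega> \<in> space M \<Longrightarrow> V \<omega> \<le> (1 - a) * (norm (y \<omega>))\<^sup>2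
      + (2 * \<eta> * (y \<omega> \<bullet> z \<omega>) + 2 * \<eta>\<^sup>2 * (norm (z \<omega>))\<^sup>2) + 3 / (2 * a) * (d \<omega>)\<^sup>2"
  shows "(\<integral>\<^sup>+\<omega>. ennreal (exp (\<kappa> * V \<omega>)) \<partial>M)
    \<le> ennreal (exp (\<kappa> * (4 * \<eta>\<^sup>2 * \<sigma>\<^sup>2 + 3 / (2 * a) * \<Delta>\<^sup>2)))
      * (\<integral>\<^sup>+\<omega>. ennreal (exp (\<kappa> * (1 - a / 2) * (norm (y \<omega>))\<^sup>2)) \<partial>M)"
proof -
  define Y where "Y \<omega> = (norm (y \<omega>))\<^sup>2" for \<omega>
  \<comment> \<open>\<open>X1\<close>, \<open>X2\<close>, \<open>X3\<close> below are the linear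
    noise, squared noise and drift parts of \<open>\<kappa> * V\<close>, scaled by 4, 4 and 2.
    \<open>A1\<close>, \<open>A2\<close>, \<open>A3\<close> bound their conditional log-moments:
    \<open>9 / 4 * (8 * \<kappa> * \<eta> * \<sigma>)\<^sup>2 * Y\<close>, twice the scaling of the
    squared noise, and the drift bound at \<open>3 * \<kappa> / a\<close>.\<close>
  define A1 where "A1 \<omega> = 144 * \<kappa>\<^sup>2 * \<eta>\<^sup>2 * \<sigma>\<^sup>2 * Y \<omega>" for \<omega>
  define A2 where "A2 = 16 * \<kappa> * \<eta>\<^sup>2 * \<sigma>\<^sup>2"
  define A3 where "A3 = 3 * \<kappa> / a * \<Delta>\<^sup>2"
  define W where "W \<omega> = exp (\<kappa> * (1 - a) * Y \<omega> + A1 \<omega> / 4 + A2 / 4 + A3 / 2)" for \<omega>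
  define X1 where "X1 \<omega> = (8 * \<kappa> * \<eta>) *\<^sub>R y \<omega> \<bullet> z \<omega>" for \<omega>
  define X2 where "X2 \<omega> = 8 * \<kappa> * \<eta>\<^sup>2 * \<sigma>\<^sup>2 * ((norm (z \<omega>))\<^sup>2 / \<sigma>\<^sup>2)" for \<omega>
  define X3 where "X3 \<omega> = 3 * \<kappa> / a * (d \<omega>)\<^sup>2" for \<omega>
  \<comment> \<open>Each weight carries the compensating factor of one term, so the three integrals
    below are all at most that of W, and so is their convex combination. The weights stay measurable
    with respect to the past.\<close>
  define h1 where "h1 \<omega> = W \<omega> * exp (- A1 \<omega>)" for \<omega>
  define h2 where "h2 \<omega> = W \<omega> * exp (- A2)" for \<omega>
  define h3 where "h3 \<omega> = W \<omega> * exp (- A3)" for \<omega>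
  have F_meas: "Y \<in> borel_measurable F" "A1 \<in> borel_measurable F" "W \<in> borel_measurable F"
    "h1 \<in> borel_measurable F" "h2 \<in> borel_measurable F" "h3 \<in> borel_measurable F"
    using y unfolding h1_def h2_def h3_def W_def A1_def Y_def by measurable
  have v_F: "(\<lambda>\<omega>. (8 * \<kappa> * \<eta>) *\<^sub>R y \<omega>) \<in> borel_measurable F" using y by measurable
  note [measurable] = measurable_from_subalg[OF subalg y]
  note [measurable] = F_meas[THEN measurable_from_subalg[OF subalg]]
  have [measurable]: "X1 \<in> borel_measurable M" "X2 \<in> borel_measurable M" "X3 \<in> borel_measurable M"
    unfolding X1_def X2_def X3_def by measurable
  have nn: "0 \<le> W \<omega>" "0 \<le> h1 \<omega>" "0 \<le> h2 \<omega>" "0 \<le> h3 \<omega>" for \<omega>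
    by (simp_all add: W_def h1_def h2_def h3_def)
  let ?W = "\<integral>\<^sup>+\<omega>. ennreal (W \<omega>) \<partial>M"

  have pt: "exp (\<kappa> * V \<omega>) \<le> h1 \<omega> * exp (X1 \<omega>) / 4 + h2 \<omega> * exp (X2 \<omega>) / 4 + h3 \<omega> * exp (X3 \<omega>) / 2"
    if "\<omega> \<in> space M" for \<omega>
  proof -
    have "\<kappa> * V \<omega> \<le> \<kappa> * ((1 - a) * (norm (y \<omega>))\<^sup>2
      + (2 * \<eta> * (y \<omega> \<bullet> z \<omega>) + 2 * \<eta>\<^sup>2 * (norm (z \<omega>))\<^sup>2) + 3 / (2 * a) * (d \<omega>)\<^sup>2)"
      using V[OF that] \<kappa>(1) by (intro mult_left_mono) auto
    also have "\<dots> = \<kappa> * (1 - a) * Y \<omega> + A1 \<omega> / 4 + A2 / 4 + A3 / 2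
        + ((X1 \<omega> - A1 \<omega>) / 4 + (X2 \<omega> - A2) / 4 + (X3 \<omega> - A3) / 2)"
      using \<sigma> a(1) by (simp add: X1_def X2_def X3_def Y_def field_simps)
    finally have "exp (\<kappa> * V \<omega>)
        \<le> W \<omega> * exp ((X1 \<omega> - A1 \<omega>) / 4 + (X2 \<omega> - A2) / 4 + (X3 \<omega> - A3) / 2)"
      by (simp add: W_def exp_add[symmetric])
    also have "\<dots> \<le> W \<omega> * (exp (X1 \<omega> - A1 \<omega>) / 4 + exp (X2 \<omega> - A2) / 4 + exp (X3 \<omega> - A3) / 2)"
      using nn by (intro mult_left_mono exp_weighted_mean_le)
    finally show ?thesis
      by (simp add: h1_def h2_def h3_def exp_diff exp_minus field_simps)
  qed

  have 1: "(\<integral>\<^sup>+\<omega>. ennreal (h1 \<omega> * exp (X1 \<omega>)) \<partial>M) \<le> ?W"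
  proof -
    have W_eq: "h1 \<omega> * exp (9 / 4 * (\<sigma> * norm ((8 * \<kappa> * \<eta>) *\<^sub>R y \<omega>))\<^sup>2) = W \<omega>" for \<omega>
    proof -
      have "9 / 4 * (\<sigma> * norm ((8 * \<kappa> * \<eta>) *\<^sub>R y \<omega>))\<^sup>2 = A1 \<omega>"
        by (simp add: A1_def Y_def power_mult_distrib)
      then show ?thesis by (simp only: h1_def mult.assoc exp_add[symmetric]) simp
    qed
    have "(\<integral>\<^sup>+\<omega>. ennreal (h1 \<omega> * exp (X1 \<omega>)) \<partial>M)
        \<le> (\<integral>\<^sup>+\<omega>. ennreal (h1 \<omega> * exp (9 / 4 * (\<sigma> * norm ((8 * \<kappa> * \<eta>) *\<^sub>R y \<omega>))\<^sup>2)) \<partial>M)"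
      unfolding X1_def by (intro weighted_exp_inner_le nn F_meas v_F z \<sigma> mean tail)
    then show ?thesis by (simp only: W_eq)
  qed

  have 2: "(\<integral>\<^sup>+\<omega>. ennreal (h2 \<omega> * exp (X2 \<omega>)) \<partial>M) \<le> ?W"
  proof -
    have "(\<integral>\<^sup>+\<omega>. ennreal (h2 \<omega> * exp (X2 \<omega>)) \<partial>M)
        \<le> ennreal (exp (2 * (8 * \<kappa> * \<eta>\<^sup>2 * \<sigma>\<^sup>2))) * (\<integral>\<^sup>+\<omega>. ennreal (h2 \<omega>) \<partial>M)"
      unfolding X2_def using \<kappa> a
      by (intro weighted_exp_norm_square_scaled_le nn F_meas z \<sigma> tail) auto
    also have "\<dots> = (\<integral>\<^sup>+\<omega>. ennreal (exp (2 * (8 * \<kappa> * \<eta>\<^sup>2 * \<sigma>\<^sup>2))) * ennreal (h2 \<omega>) \<partial>M)"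
      by (simp add: nn_integral_cmult)
    also have "\<dots> = ?W"
      by (intro nn_integral_cong) (simp add: ennreal_mult[symmetric] nn h2_def A2_def exp_minus mult.assoc)
    finally show ?thesis .
  qed

  have 3: "(\<integral>\<^sup>+\<omega>. ennreal (h3 \<omega> * exp (X3 \<omega>)) \<partial>M) \<le> ?W"
  proof -
    define s where "s = 3 * \<kappa> / a"
    have h3_F: "(\<lambda>\<omega>. ennreal (h3 \<omega>)) \<in> borel_measurable F"
      by (rule measurable_compose[OF F_meas(6) measurable_ennreal])
    have s: "0 \<le> s" "s \<le> 1 / \<Delta>\<^sup>2" using \<kappa> a \<Delta> by (auto simp: s_def field_simps)
    have "(\<integral>\<^sup>+\<omega>. ennreal (h3 \<omega> * exp (X3 \<omega>)) \<partial>M)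
        = (\<integral>\<^sup>+\<omega>. ennreal (h3 \<omega>) * ennreal (exp (s * (d \<omega>)\<^sup>2)) \<partial>M)"
      by (simp add: ennreal_mult nn X3_def s_def)
    also have "\<dots> = (\<integral>\<^sup>+\<omega>. ennreal (h3 \<omega>)
        * nn_cond_exp M F (\<lambda>\<omega>. ennreal (exp (s * (d \<omega>)\<^sup>2))) \<omega> \<partial>M)"
      by (rule nn_cond_exp_intg[symmetric, OF h3_F]) measurable
    also have "\<dots> \<le> (\<integral>\<^sup>+\<omega>. ennreal (h3 \<omega>) * ennreal (exp (s * \<Delta>\<^sup>2)) \<partial>M)"
      using drift[OF s] by (intro nn_integral_mono_AE) (auto intro!: mult_left_mono)
    also have "\<dots> = ?W"
      by (intro nn_integral_cong) (simp add: ennreal_mult[symmetric] nn h3_def A3_def s_def exp_minus)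
    finally show ?thesis .
  qed

  have split: "ennreal (p / 4 + q / 4 + r / 2)
      = ennreal (1 / 4) * ennreal p + ennreal (1 / 4) * ennreal q + ennreal (1 / 2) * ennreal r"
    if "0 \<le> p" "0 \<le> q" "0 \<le> r" for p q r
  proof -
    have "ennreal (p / 4 + q / 4 + r / 2)
        = ennreal (1 / 4 * p) + ennreal (1 / 4 * q) + ennreal (1 / 2 * r)"
      using that by simp
    then show ?thesis by (simp only: ennreal_mult' zero_le_divide_1_iff zero_le_numeral)
  qed
  have "(\<integral>\<^sup>+\<omega>. ennreal (exp (\<kappa> * V \<omega>)) \<partial>M)
      \<le> (\<integral>\<^sup>+\<omega>. ennreal (1 / 4) * ennreal (h1 \<omega> * exp (X1 \<omega>)) + ennreal (1 / 4) * ennreal (h2 \<omega> * exp (X2 \<omega>))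
          + ennreal (1 / 2) * ennreal (h3 \<omega> * exp (X3 \<omega>)) \<partial>M)"
  proof (rule nn_integral_mono)
    fix \<omega> assume "\<omega> \<in> space M"
    from ennreal_leI[OF pt[OF this]]
    show "ennreal (exp (\<kappa> * V \<omega>)) \<le> ennreal (1 / 4) * ennreal (h1 \<omega> * exp (X1 \<omega>))
        + ennreal (1 / 4) * ennreal (h2 \<omega> * exp (X2 \<omega>)) + ennreal (1 / 2) * ennreal (h3 \<omega> * exp (X3 \<omega>))"
      by (subst (asm) split) (use nn[of \<omega>] in auto)
  qed
  also have "\<dots> = ennreal (1 / 4) * (\<integral>\<^sup>+\<omega>. ennreal (h1 \<omega> * exp (X1 \<omega>)) \<partial>M)
      + ennreal (1 / 4) * (\<integral>\<^sup>+\<omega>. ennreal (h2 \<omega> * exp (X2 \<omega>)) \<partial>M)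
      + ennreal (1 / 2) * (\<integral>\<^sup>+\<omega>. ennreal (h3 \<omega> * exp (X3 \<omega>)) \<partial>M)"
    by (simp add: nn_integral_add nn_integral_cmult)
  also have "\<dots> \<le> ennreal (1 / 4) * ?W + ennreal (1 / 4) * ?W + ennreal (1 / 2) * ?W"
    by (intro add_mono mult_left_mono 1 2 3) auto
  also have "\<dots> = ennreal (1 / 4 + 1 / 4 + 1 / 2) * ?W"
    by (subst ennreal_plus, simp, simp, subst ennreal_plus, simp, simp, simp only: distrib_right)
  also have "\<dots> = ?W" by simp
  also have "?W \<le> (\<integral>\<^sup>+\<omega>. ennreal (exp (\<kappa> * (4 * \<eta>\<^sup>2 * \<sigma>\<^sup>2 + 3 / (2 * a) * \<Delta>\<^sup>2)))
      * ennreal (exp (\<kappa> * (1 - a / 2) * (norm (y \<omega>))\<^sup>2)) \<partial>M)"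
  proof (rule nn_integral_mono)
    fix \<omega>
    \<comment> \<open>Here \<open>A1 / 4 = 36 * \<kappa>\<^sup>2 * \<eta>\<^sup>2 * \<sigma>\<^sup>2
      * Y\<close> is absorbed by half of the contraction; this dictates the 72. The rest,
      \<open>A2 / 4 + A3 / 2\<close>, is the additive cost.\<close>
    have "(72 * \<kappa> * \<eta>\<^sup>2 * \<sigma>\<^sup>2) * (\<kappa> * Y \<omega>) \<le> a * (\<kappa> * Y \<omega>)"
      using \<kappa> by (intro mult_right_mono) (auto simp: Y_def)
    then have "A1 \<omega> / 4 \<le> \<kappa> * (a / 2) * Y \<omega>" by (simp add: A1_def power2_eq_square ac_simps)
    then have "\<kappa> * (1 - a) * Y \<omega> + A1 \<omega> / 4 + A2 / 4 + A3 / 2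
        \<le> \<kappa> * (4 * \<eta>\<^sup>2 * \<sigma>\<^sup>2 + 3 / (2 * a) * \<Delta>\<^sup>2) + \<kappa> * (1 - a / 2) * Y \<omega>"
      by (simp add: A2_def A3_def algebra_simps)
    then show "ennreal (W \<omega>) \<le> ennreal (exp (\<kappa> * (4 * \<eta>\<^sup>2 * \<sigma>\<^sup>2 + 3 / (2 * a) * \<Delta>\<^sup>2)))
      * ennreal (exp (\<kappa> * (1 - a / 2) * (norm (y \<omega>))\<^sup>2))"
      by (simp add: W_def Y_def ennreal_mult[symmetric] exp_add[symmetric] ennreal_leI)
  qed
  finally show ?thesis by (simp add: nn_integral_cmult)
qed


section \<open>Iterated exponential moments and the tail bound\<close>

lemma trivial_sigma_algebra_constant:
  fixes f :: "'a \<Rightarrow> 'b::t1_space"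
  assumes f: "f \<in> borel_measurable N" and N: "sets N = {{}, S}"
    and \<omega>: "\<omega> \<in> space N" "\<omega>' \<in> space N"
  shows "f \<omega> = f \<omega>'"
proof -
  have "f -` {f \<omega>'} \<inter> space N \<in> {{}, S}" unfolding N[symmetric]
    using f by (rule measurable_sets) simp
  moreover have "space N \<in> {{}, S}" unfolding N[symmetric] by (rule sets.top)
  ultimately have "f -` {f \<omega>'} \<inter> space N = space N" using \<omega> by auto
  with \<omega> show ?thesis by auto
qed

lemma vec_cond_exp_eq_0D:
  assumes "vec_cond_exp M G X \<omega> = 0" "b \<in> Basis"
  shows "real_cond_exp M G (\<lambda>\<omega>'. X \<omega>' \<bullet> b) \<omega> = 0"
proof -
  have "vec_cond_exp M G X \<omega> \<bullet> b = real_cond_exp M G (\<lambda>\<omega>'. X \<omega>' \<bullet> b) \<omega>"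
    unfolding vec_cond_exp_def using assms(2) by (rule inner_sum_left_Basis)
  with assms(1) show ?thesis by simp
qed

context stochastic_framework
begin

text \<open>As \<open>F 0\<close> carries no information, the initial error is a number: it leaves
  the integral at the start of the induction and agrees across outcomes in the final event.\<close>

lemma initial_constant:
  assumes "\<omega> \<in> space M" "\<omega>' \<in> space M"
  shows "x 0 \<omega> = x 0 \<omega>'" "xbar 0 \<omega> = xbar 0 \<omega>'"
proof -
  have "\<omega> \<in> space (F 0)" "\<omega>' \<in> space (F 0)"
    using assms subalgebra_F[of 0] by (auto simp: subalgebra_def)
  then show "x 0 \<omega> = x 0 \<omega>'" "xbar 0 \<omega> = xbar 0 \<omega>'"
    by (rule trivial_sigma_algebra_constant[OF x_measurable F_0]
      trivial_sigma_algebra_constant[OF xbar_measurable F_0])+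
qed

text \<open>A step trades \<kappa> for \<open>\<kappa> * (1 - a / 2)\<close>, so the induction runs
  over all admissible \<kappa> at once; the smallness conditions pass to smaller values.\<close>

lemma exp_moment_le:
  fixes a \<eta> \<sigma> \<Delta> :: real
  defines "C \<equiv> 4 * \<eta>\<^sup>2 * \<sigma>\<^sup>2 + 3 / (2 * a) * \<Delta>\<^sup>2"
  assumes \<sigma>: "0 < \<sigma>" and \<Delta>: "0 < \<Delta>" and a: "0 < a" "a \<le> 1 / 2" and \<eta>: "0 < \<eta>"
    and tail: "\<And>t \<tau>. 0 < \<tau> \<Longrightarrow> AE \<omega> in M. real_cond_exp M (F t)
      (indicator {\<omega> \<in> space M. \<tau> \<le> norm (z t \<omega>)}) \<omega> \<le> 2 * exp (- 2 * \<tau>\<^sup>2 / \<sigma>\<^sup>2)"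
    and drift: "\<And>t s. 0 \<le> s \<Longrightarrow> s \<le> 1 / \<Delta>\<^sup>2 \<Longrightarrow> AE \<omega> in M. nn_cond_exp M (F t)
      (\<lambda>\<omega>. ennreal (exp (s * (norm (xbar t \<omega> - xbar (Suc t) \<omega>))\<^sup>2))) \<omega> \<le> ennreal (exp (s * \<Delta>\<^sup>2))"
    and step: "\<And>t \<omega>. \<omega> \<in> space M \<Longrightarrow> (norm (x (Suc t) \<omega> - xbar (Suc t) \<omega>))\<^sup>2
      \<le> (1 - a) * (norm (x t \<omega> - xbar t \<omega>))\<^sup>2
        + (2 * \<eta> * ((x t \<omega> - xbar t \<omega>) \<bullet> z t \<omega>) + 2 * \<eta>\<^sup>2 * (norm (z t \<omega>))\<^sup>2)
        + 3 / (2 * a) * (norm (xbar t \<omega> - xbar (Suc t) \<omega>))\<^sup>2"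
    and \<omega>0: "\<omega>0 \<in> space M"
    and \<kappa>: "0 < \<kappa>" "72 * \<kappa> * \<eta>\<^sup>2 * \<sigma>\<^sup>2 \<le> a" "3 * \<kappa> * \<Delta>\<^sup>2 \<le> a"
  shows "(\<integral>\<^sup>+\<omega>. ennreal (exp (\<kappa> * (norm (x t \<omega> - xbar t \<omega>))\<^sup>2)) \<partial>M)
    \<le> ennreal (exp (\<kappa> * ((1 - a / 2) ^ t * (norm (x 0 \<omega>0 - xbar 0 \<omega>0))\<^sup>2 + 2 * C / a)))"
  using \<kappa>
proof (induction t arbitrary: \<kappa>)
  case 0
  have C: "0 \<le> 2 * C / a" using a by (simp add: C_def)
  have "(\<integral>\<^sup>+\<omega>. ennreal (exp (\<kappa> * (norm (x 0 \<omega> - xbar 0 \<omega>))\<^sup>2)) \<partial>M)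
      = (\<integral>\<^sup>+\<omega>. ennreal (exp (\<kappa> * (norm (x 0 \<omega>0 - xbar 0 \<omega>0))\<^sup>2)) \<partial>M)"
  proof (rule nn_integral_cong)
    fix \<omega> assume "\<omega> \<in> space M"
    from initial_constant[OF this \<omega>0]
    show "ennreal (exp (\<kappa> * (norm (x 0 \<omega> - xbar 0 \<omega>))\<^sup>2))
      = ennreal (exp (\<kappa> * (norm (x 0 \<omega>0 - xbar 0 \<omega>0))\<^sup>2))" by simp
  qed
  also have "\<dots> = ennreal (exp (\<kappa> * (norm (x 0 \<omega>0 - xbar 0 \<omega>0))\<^sup>2))" by (simp add: emeasure_space_1)
  finally show ?case using C 0(1) by (auto intro!: ennreal_leI mult_left_mono)
next
  case (Suc t)
  interpret finite_measure_subalgebra M "F t"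
    by unfold_locales (rule subalgebra_F)
  define \<kappa>' where "\<kappa>' = \<kappa> * (1 - a / 2)"
  let ?V0 = "(norm (x 0 \<omega>0 - xbar 0 \<omega>0))\<^sup>2"
  have \<kappa>': "0 < \<kappa>'" "\<kappa>' \<le> \<kappa>" using a Suc.prems(1) by (auto simp: \<kappa>'_def mult_left_le)
  have meas_M[measurable]: "x t \<in> borel_measurable M" "xbar t \<in> borel_measurable M" "z t \<in> borel_measurable M" for t
    by (rule measurable_from_subalg[OF subalgebra_F] x_measurable xbar_measurable z_measurable)+
  have y_meas: "(\<lambda>\<omega>. x t \<omega> - xbar t \<omega>) \<in> borel_measurable (F t)"
    using x_measurable[of t] xbar_measurable[of t] by (rule borel_measurable_diff)
  have d_meas: "(\<lambda>\<omega>. norm (xbar t \<omega> - xbar (Suc t) \<omega>)) \<in> borel_measurable M" by measurable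
  have mean: "AE \<omega> in M. real_cond_exp M (F t) (\<lambda>\<omega>. z t \<omega> \<bullet> b) \<omega> = 0" if "b \<in> Basis" for b
    using z_mean_zero[of t] by eventually_elim (rule vec_cond_exp_eq_0D[OF _ that])
  have "(\<integral>\<^sup>+\<omega>. ennreal (exp (\<kappa> * (norm (x (Suc t) \<omega> - xbar (Suc t) \<omega>))\<^sup>2)) \<partial>M)
    \<le> ennreal (exp (\<kappa> * C))
      * (\<integral>\<^sup>+\<omega>. ennreal (exp (\<kappa> * (1 - a / 2) * (norm (x t \<omega> - xbar t \<omega>))\<^sup>2)) \<partial>M)"
    unfolding C_def
    by (rule exp_moment_step[OF y_meas meas_M(3) d_meas \<sigma> \<Delta> a \<eta> Suc.prems mean tail drift step])
  also have "\<dots> \<le> ennreal (exp (\<kappa> * C)) * ennreal (exp (\<kappa>' * ((1 - a / 2) ^ t * ?V0 + 2 * C / a)))"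
  proof (intro mult_left_mono)
    have "72 * \<kappa>' * \<eta>\<^sup>2 * \<sigma>\<^sup>2 \<le> 72 * \<kappa> * \<eta>\<^sup>2 * \<sigma>\<^sup>2" "3 * \<kappa>' * \<Delta>\<^sup>2 \<le> 3 * \<kappa> * \<Delta>\<^sup>2"
      using \<kappa>' by (auto intro!: mult_right_mono)
    with \<kappa>' Suc.prems
    show "(\<integral>\<^sup>+\<omega>. ennreal (exp (\<kappa> * (1 - a / 2) * (norm (x t \<omega> - xbar t \<omega>))\<^sup>2)) \<partial>M)
      \<le> ennreal (exp (\<kappa>' * ((1 - a / 2) ^ t * ?V0 + 2 * C / a)))"
      unfolding \<kappa>'_def[symmetric] by (intro Suc.IH) linarith+
  qed simp
  also have "\<dots> = ennreal (exp (\<kappa> * C + \<kappa>' * ((1 - a / 2) ^ t * ?V0 + 2 * C / a)))"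
    by (simp add: ennreal_mult[symmetric] exp_add)
  \<comment> \<open>The value \<open>2 * C / a\<close> is the fixed point of
    \<open>b \<mapsto> (1 - a / 2) * b + C\<close>, so the additive part does not grow with
    t.\<close>
  also have "\<kappa> * C + \<kappa>' * ((1 - a / 2) ^ t * ?V0 + 2 * C / a)
      = \<kappa> * ((1 - a / 2) ^ Suc t * ?V0 + 2 * C / a)"
    using a by (simp add: \<kappa>'_def field_simps)
  finally show ?case .
qed

lemma tracking_error_high_probability:
  fixes a \<eta> \<sigma> \<Delta> \<delta> :: real
  assumes \<sigma>: "0 < \<sigma>" and \<Delta>: "0 < \<Delta>" and a: "0 < a" "a \<le> 1 / 2" and \<eta>: "0 < \<eta>"
    and tail: "\<And>t \<tau>. 0 < \<tau> \<Longrightarrow> AE \<omega> in M. real_cond_exp M (F t)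
      (indicator {\<omega> \<in> space M. \<tau> \<le> norm (z t \<omega>)}) \<omega> \<le> 2 * exp (- 2 * \<tau>\<^sup>2 / \<sigma>\<^sup>2)"
    and drift: "\<And>t s. 0 \<le> s \<Longrightarrow> s \<le> 1 / \<Delta>\<^sup>2 \<Longrightarrow> AE \<omega> in M. nn_cond_exp M (F t)
      (\<lambda>\<omega>. ennreal (exp (s * (norm (xbar t \<omega> - xbar (Suc t) \<omega>))\<^sup>2))) \<omega> \<le> ennreal (exp (s * \<Delta>\<^sup>2))"
    and step: "\<And>t \<omega>. \<omega> \<in> space M \<Longrightarrow> (norm (x (Suc t) \<omega> - xbar (Suc t) \<omega>))\<^sup>2
      \<le> (1 - a) * (norm (x t \<omega> - xbar t \<omega>))\<^sup>2
        + (2 * \<eta> * ((x t \<omega> - xbar t \<omega>) \<bullet> z t \<omega>) + 2 * \<eta>\<^sup>2 * (norm (z t \<omega>))\<^sup>2)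
        + 3 / (2 * a) * (norm (xbar t \<omega> - xbar (Suc t) \<omega>))\<^sup>2"
    and \<delta>: "0 < \<delta>" "\<delta> < 1"
  shows "1 - \<delta> \<le> measure M {\<omega> \<in> space M. (norm (x t \<omega> - xbar t \<omega>))\<^sup>2
    \<le> (1 - a / 2) ^ t * (norm (x 0 \<omega> - xbar 0 \<omega>))\<^sup>2
      + (72 * \<eta>\<^sup>2 * \<sigma>\<^sup>2 / a + 4 * (\<Delta> / a)\<^sup>2) * ln (exp 1 / \<delta>)}"
proof -
  \<comment> \<open>With this reciprocal the left-hand sides of the two smallness conditions sum to
    exactly a, so each condition holds, and \<open>1 / \<kappa>\<close> is a plain sum that compares
    with the stated coefficient.\<close>
  define \<kappa> where "\<kappa> = 1 / (72 * \<eta>\<^sup>2 * \<sigma>\<^sup>2 / a + 3 * \<Delta>\<^sup>2 / a)"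
  define C where "C = 4 * \<eta>\<^sup>2 * \<sigma>\<^sup>2 + 3 / (2 * a) * \<Delta>\<^sup>2"
  define V where "V \<omega> = (norm (x t \<omega> - xbar t \<omega>))\<^sup>2" for \<omega>
  define l where "l = ln (1 / \<delta>)"
  obtain \<omega>0 where \<omega>0: "\<omega>0 \<in> space M" using not_empty by blast
  define B where "B = (1 - a / 2) ^ t * (norm (x 0 \<omega>0 - xbar 0 \<omega>0))\<^sup>2"
  let ?R = "(72 * \<eta>\<^sup>2 * \<sigma>\<^sup>2 / a + 4 * (\<Delta> / a)\<^sup>2) * ln (exp 1 / \<delta>)"
  \<comment> \<open>The moment bound accounts for \<open>B + 2 * C / a\<close>; the surplus
    \<open>l / \<kappa>\<close> makes Markov's inequality return
    \<open>exp (- l) = \<delta>\<close>.\<close>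
  let ?b = "B + 2 * C / a + l / \<kappa>"
  have [measurable]: "x t \<in> borel_measurable M" "xbar t \<in> borel_measurable M" for t
    by (rule measurable_from_subalg[OF subalgebra_F] x_measurable xbar_measurable)+
  have [measurable]: "V \<in> borel_measurable M" unfolding V_def by measurable
  have pos: "0 < \<eta>\<^sup>2 * \<sigma>\<^sup>2" "0 < \<Delta>\<^sup>2" using \<eta> \<sigma> \<Delta> by simp_all
  then have \<kappa>0: "0 < \<kappa>" using a by (auto simp: \<kappa>_def intro!: divide_pos_pos add_pos_pos)
  have \<kappa>_inv: "1 / \<kappa> = 72 * \<eta>\<^sup>2 * \<sigma>\<^sup>2 / a + 3 * \<Delta>\<^sup>2 / a" by (simp add: \<kappa>_def)
  then have "\<kappa> * (72 * \<eta>\<^sup>2 * \<sigma>\<^sup>2) + \<kappa> * (3 * \<Delta>\<^sup>2) = a" using \<kappa>0 a by (simp add: field_simps)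
  moreover have "0 < \<kappa> * (72 * \<eta>\<^sup>2 * \<sigma>\<^sup>2)" "0 < \<kappa> * (3 * \<Delta>\<^sup>2)" using pos \<kappa>0 \<eta> \<sigma> \<Delta> by simp_all
  ultimately have \<kappa>: "72 * \<kappa> * \<eta>\<^sup>2 * \<sigma>\<^sup>2 \<le> a" "3 * \<kappa> * \<Delta>\<^sup>2 \<le> a" by (simp_all add: ac_simps)
  have "emeasure M {\<omega> \<in> space M. ?b \<le> V \<omega>}
      \<le> ennreal (exp (- \<kappa> * ?b)) * (\<integral>\<^sup>+\<omega>. ennreal (exp (\<kappa> * V \<omega>)) * indicator (space M) \<omega> \<partial>M)"
    by (rule Chernoff_ineq_nn_integral_ge) (use \<kappa>0 in auto)
  also have "(\<integral>\<^sup>+\<omega>. ennreal (exp (\<kappa> * V \<omega>)) * indicator (space M) \<omega> \<partial>M)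
      = (\<integral>\<^sup>+\<omega>. ennreal (exp (\<kappa> * V \<omega>)) \<partial>M)"
    by (intro nn_integral_cong) simp
  also have "\<dots> \<le> ennreal (exp (\<kappa> * (B + 2 * C / a)))"
    unfolding V_def B_def C_def
    by (rule exp_moment_le[OF \<sigma> \<Delta> a \<eta> tail drift step \<omega>0 \<kappa>0 \<kappa>])
  also have "ennreal (exp (- \<kappa> * ?b)) * ennreal (exp (\<kappa> * (B + 2 * C / a)))
      = ennreal (exp (- \<kappa> * ?b + \<kappa> * (B + 2 * C / a)))"
    by (simp only: ennreal_mult[symmetric] exp_add exp_ge_zero)
  also have "- \<kappa> * ?b + \<kappa> * (B + 2 * C / a) = - l" using \<kappa>0 by (simp add: algebra_simps)
  also have "exp (- l) = \<delta>" using \<delta> by (simp add: l_def exp_minus)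
  finally have bad: "measure M {\<omega> \<in> space M. ?b \<le> V \<omega>} \<le> \<delta>"
    using \<delta> by (simp add: emeasure_eq_measure mult_left_mono)
  \<comment> \<open>Both \<open>2 * C / a\<close> and \<open>1 / \<kappa>\<close> are at most the
    coefficient in \<open>?R\<close>, and the logarithm equals \<open>1 + l\<close>. The drift part
    of \<open>1 / \<kappa>\<close> fits since \<open>3 * a \<le> 4\<close>.\<close>
  have "?b \<le> B + ?R"
  proof -
    have l: "0 \<le> l" using \<delta> by (simp add: l_def)
    have ln: "ln (exp 1 / \<delta>) = 1 + l" using \<delta> by (simp add: l_def ln_div)
    have "2 * C / a = 8 * \<eta>\<^sup>2 * \<sigma>\<^sup>2 / a + 3 * (\<Delta> / a)\<^sup>2"
      using a by (simp add: C_def field_simps power2_eq_square)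
    moreover have "0 \<le> \<eta>\<^sup>2 * \<sigma>\<^sup>2 / a" using a by simp
    ultimately have 1: "2 * C / a \<le> 72 * \<eta>\<^sup>2 * \<sigma>\<^sup>2 / a + 4 * (\<Delta> / a)\<^sup>2"
      by (simp add: add_mono)
    have "3 * \<Delta>\<^sup>2 / a \<le> 4 * (\<Delta> / a)\<^sup>2"
    proof -
      have "3 * \<Delta>\<^sup>2 / a = 3 * a * (\<Delta> / a)\<^sup>2" using a by (simp add: field_simps power2_eq_square)
      also have "\<dots> \<le> 4 * (\<Delta> / a)\<^sup>2" using a by (intro mult_right_mono) auto
      finally show ?thesis .
    qed
    then have 2: "1 / \<kappa> \<le> 72 * \<eta>\<^sup>2 * \<sigma>\<^sup>2 / a + 4 * (\<Delta> / a)\<^sup>2" by (simp add: \<kappa>_inv)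
    have "p + l / \<kappa> \<le> K * (1 + l)" if "p \<le> K" "1 / \<kappa> \<le> K" for p K
      using that(1) mult_left_mono[OF that(2) l] by (simp add: algebra_simps)
    from this[OF 1 2] show ?thesis unfolding ln by linarith
  qed
  then have le: "V \<omega> \<le> (1 - a / 2) ^ t * (norm (x 0 \<omega> - xbar 0 \<omega>))\<^sup>2 + ?R"
    if "\<omega> \<in> space M" "\<not> ?b \<le> V \<omega>" for \<omega>
    using that(2) unfolding initial_constant[OF that(1) \<omega>0] B_def by linarith
  have good_meas: "{\<omega> \<in> space M. V \<omega> \<le> k * (norm (x 0 \<omega> - xbar 0 \<omega>))\<^sup>2 + k'} \<in> sets M" for k k'
    by measurable
  have "space M - {\<omega> \<in> space M. ?b \<le> V \<omega>} \<subseteq> {\<omega> \<in> space M. V \<omega>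
      \<le> (1 - a / 2) ^ t * (norm (x 0 \<omega> - xbar 0 \<omega>))\<^sup>2 + ?R}" (is "_ \<subseteq> ?good")
    using le by blast
  moreover have "?good \<in> sets M" by (rule good_meas)
  ultimately have "measure M (space M - {\<omega> \<in> space M. ?b \<le> V \<omega>}) \<le> measure M ?good"
    by (intro finite_measure_mono)
  moreover have "measure M (space M - {\<omega> \<in> space M. ?b \<le> V \<omega>}) = 1 - measure M {\<omega> \<in> space M. ?b \<le> V \<omega>}"
    by (intro prob_compl) measurable
  ultimately show ?thesis using bad by (simp add: V_def)
qed

end

section \<open>The problem family as an instance of the tracking estimate\<close>

lemma gradient_sensitivity_nonneg:
  fixes f :: "nat \<Rightarrow> 'w \<Rightarrow> 'a \<Rightarrow> 'a::euclidean_space \<Rightarrow> real"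
  assumes \<gamma>: "ereal \<gamma> = gradient_sensitivity \<Omega> f" and "\<omega> \<in> \<Omega>"
  shows "0 \<le> \<gamma>"
proof -
  obtain b :: 'a where "b \<in> Basis" using nonempty_Basis by blast
  then have "norm (b - 0) = 1" by simp
  moreover have "0 \<le> \<gamma> * norm (b - 0)"
    by (rule order_trans[OF norm_ge_zero gradient_sensitivity_bound[OF assms]])
  ultimately show ?thesis by simp
qed

lemma (in problem_family) prox_gradient_iterate_step:
  assumes eqm: "\<forall>t. \<forall>\<omega>\<in>\<Omega>. equilibrium (f t \<omega>) (r t \<omega>) (xbar t \<omega>)"
    and \<eta>: "0 < \<eta>" "\<eta> \<le> 1 / (2 * L)"
    and it: "prox_gradient_iterates \<Omega> r (\<lambda>_. \<eta>) x g"
    and \<omega>: "\<omega> \<in> \<Omega>"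
  defines "a \<equiv> (\<mu> - \<gamma>) * \<eta>" and "z \<equiv> gradient_noise f x g"
  shows "0 < a" and "a \<le> 1 / 2"
    and "(norm (x (Suc t) \<omega> - xbar (Suc t) \<omega>))\<^sup>2
      \<le> (1 - a) * (norm (x t \<omega> - xbar t \<omega>))\<^sup>2
        + (2 * \<eta> * ((x t \<omega> - xbar t \<omega>) \<bullet> z t \<omega>) + 2 * \<eta>\<^sup>2 * (norm (z t \<omega>))\<^sup>2)
        + 3 / (2 * a) * (norm (xbar t \<omega> - xbar (Suc t) \<omega>))\<^sup>2"
proof -
  have \<gamma>0: "0 \<le> \<gamma>" by (rule gradient_sensitivity_nonneg[OF \<gamma>_eq \<omega>])
  show a: "0 < a" using \<eta> \<gamma>_less by (simp add: a_def)
  \<comment> \<open>Nonnegativity of \<gamma> gives \<open>\<mu> - \<gamma> \<le> L\<close>, so the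
    step size bound \<open>\<eta> * L \<le> 1 / 2\<close> carries over to a.\<close>
  have "\<mu> \<le> L" by (rule strongly_convex_smooth_le[OF f_strongly_convex[OF \<omega>] f_smooth[OF \<omega>]])
  then have "a \<le> L * \<eta>" unfolding a_def using \<gamma>0 \<eta> by (intro mult_right_mono) auto
  also have "L * \<eta> \<le> 1 / 2" using \<eta> L_pos by (simp add: field_simps)
  finally show a': "a \<le> 1 / 2" .
  have "(1 + \<eta> * (\<mu> - \<gamma>)) * (norm (x (Suc t) \<omega> - xbar t \<omega>))\<^sup>2
      \<le> (1 - \<eta> * (\<mu> - \<gamma>)) * (norm (x t \<omega> - xbar t \<omega>))\<^sup>2
        + 2 * \<eta> * ((x t \<omega> - xbar t \<omega>) \<bullet> z t \<omega>) + 2 * \<eta>\<^sup>2 * (norm (z t \<omega>))\<^sup>2"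
  proof (rule prox_gradient_step[where f = "f t \<omega>" and \<rho> = "r t \<omega>" and g = "g t \<omega>"])
    show "x (Suc t) \<omega> = prox \<eta> (r t \<omega>) (x t \<omega> - \<eta> *\<^sub>R g t \<omega>)"
      using it \<omega> by (simp add: prox_gradient_iterates_def)
    show "z t \<omega> = gradient (f t \<omega> (x t \<omega>)) (x t \<omega>) - g t \<omega>" by (simp add: z_def gradient_noise_def)
    show "equilibrium (f t \<omega>) (r t \<omega>) (xbar t \<omega>)" using eqm \<omega> by blast
  qed (use f_strongly_convex[OF \<omega>] f_smooth[OF \<omega>] r_proper_closed_convex[OF \<omega>]
      gradient_sensitivity_bound[OF \<gamma>_eq \<omega>] \<gamma>0 L_pos \<eta> in blast)+
  then show "(norm (x (Suc t) \<omega> - xbar (Suc t) \<omega>))\<^sup>2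
      \<le> (1 - a) * (norm (x t \<omega> - xbar t \<omega>))\<^sup>2
        + (2 * \<eta> * ((x t \<omega> - xbar t \<omega>) \<bullet> z t \<omega>) + 2 * \<eta>\<^sup>2 * (norm (z t \<omega>))\<^sup>2)
        + 3 / (2 * a) * (norm (xbar t \<omega> - xbar (Suc t) \<omega>))\<^sup>2"
    by (intro prox_gradient_tracking_step a a') (simp add: a_def mult.commute)
qed

theorem theorem30:
  shows "\<exists>c::real. 0 < c \<and> c \<le> absolute_cap \<and>
    (\<forall>(M :: 'w measure) F
      (f :: nat \<Rightarrow> 'w \<Rightarrow> 'a::euclidean_space \<Rightarrow> 'a \<Rightarrow> real) r \<mu> L \<gamma> xbar x g \<eta> \<Delta> \<sigma>.
      problem_family (space M) f r \<mu> L \<gamma> \<and>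
      (\<forall>t. \<forall>\<omega>\<in>space M. equilibrium (f t \<omega>) (r t \<omega>) (xbar t \<omega>)) \<and>
      0 < \<eta> \<and> \<eta> \<le> 1 / (2 * L) \<and>
      prox_gradient_iterates (space M) r (\<lambda>_. \<eta>) x g \<and>
      stochastic_framework M F x xbar (gradient_noise f x g) \<and>
      0 < \<Delta> \<and> 0 < \<sigma> \<and>
      (\<forall>t. \<forall>s::real. 0 \<le> s \<and> s \<le> 1 / \<Delta>\<^sup>2 \<longrightarrow>
        (AE \<omega> in M. nn_cond_exp M (F t)
            (\<lambda>\<omega>'. ennreal (exp (s * (norm (xbar t \<omega>' - xbar (Suc t) \<omega>'))\<^sup>2))) \<omega>
          \<le> ennreal (exp (s * \<Delta>\<^sup>2)))) \<and>
      (\<forall>t. \<forall>\<tau>>0.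
        AE \<omega> in M. real_cond_exp M (F t)
            (indicator {\<omega>' \<in> space M. \<tau> \<le> norm (gradient_noise f x g t \<omega>')}) \<omega>
          \<le> 2 * exp (- 2 * \<tau>\<^sup>2 / \<sigma>\<^sup>2))
      \<longrightarrow>
      (\<forall>t. \<forall>\<delta>::real. 0 < \<delta> \<and> \<delta> < 1 \<longrightarrow>
        1 - \<delta> \<le> measure M {\<omega> \<in> space M.
          (norm (x t \<omega> - xbar t \<omega>))\<^sup>2
            \<le> (1 - (\<mu> - \<gamma>) * \<eta> / 2) ^ t * (norm (x 0 \<omega> - xbar 0 \<omega>))\<^sup>2
              + (8 * \<eta> * (c * \<sigma>)\<^sup>2 / (\<mu> - \<gamma>) + 4 * (\<Delta> / ((\<mu> - \<gamma>) * \<eta>))\<^sup>2)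
                * ln (exp 1 / \<delta>)}))"
proof (intro exI[of _ absolute_cap] conjI allI impI)
  show "0 < absolute_cap" by (simp add: absolute_cap_def)
  show "absolute_cap \<le> absolute_cap" by simp
next
  fix M :: "'w measure" and F and f :: "nat \<Rightarrow> 'w \<Rightarrow> 'a \<Rightarrow> 'a \<Rightarrow> real" and r
    and \<mu> L \<gamma> :: real and xbar x g and \<eta> \<Delta> \<sigma> :: real and t and \<delta> :: real
  assume *: "problem_family (space M) f r \<mu> L \<gamma> \<and>
      (\<forall>t. \<forall>\<omega>\<in>space M. equilibrium (f t \<omega>) (r t \<omega>) (xbar t \<omega>)) \<and>
      0 < \<eta> \<and> \<eta> \<le> 1 / (2 * L) \<and>
      prox_gradient_iterates (space M) r (\<lambda>_. \<eta>) x g \<and>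
      stochastic_framework M F x xbar (gradient_noise f x g) \<and>
      0 < \<Delta> \<and> 0 < \<sigma> \<and>
      (\<forall>t. \<forall>s::real. 0 \<le> s \<and> s \<le> 1 / \<Delta>\<^sup>2 \<longrightarrow>
        (AE \<omega> in M. nn_cond_exp M (F t)
            (\<lambda>\<omega>'. ennreal (exp (s * (norm (xbar t \<omega>' - xbar (Suc t) \<omega>'))\<^sup>2))) \<omega>
          \<le> ennreal (exp (s * \<Delta>\<^sup>2)))) \<and>
      (\<forall>t. \<forall>\<tau>>0.
        AE \<omega> in M. real_cond_exp M (F t)
            (indicator {\<omega>' \<in> space M. \<tau> \<le> norm (gradient_noise f x g t \<omega>')}) \<omega>
          \<le> 2 * exp (- 2 * \<tau>\<^sup>2 / \<sigma>\<^sup>2))"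
    and \<delta>: "0 < \<delta> \<and> \<delta> < 1"
  define a where "a = (\<mu> - \<gamma>) * \<eta>"
  from * interpret problem_family "space M" f r \<mu> L \<gamma> by blast
  from * interpret S: stochastic_framework M F x xbar "gradient_noise f x g" by blast
  obtain \<omega>0 where \<omega>0: "\<omega>0 \<in> space M" using S.not_empty by blast
  have \<eta>: "0 < \<eta>" "\<eta> \<le> 1 / (2 * L)" and \<sigma>: "0 < \<sigma>" and \<Delta>: "0 < \<Delta>"
    and eqm: "\<forall>t. \<forall>\<omega>\<in>space M. equilibrium (f t \<omega>) (r t \<omega>) (xbar t \<omega>)"
    and it: "prox_gradient_iterates (space M) r (\<lambda>_. \<eta>) x g"
    using * by blast+
  note step = prox_gradient_iterate_step[OF eqm \<eta> it, folded a_def]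
  have a: "0 < a" "a \<le> 1 / 2" using step(1,2)[OF \<omega>0] .
  \<comment> \<open>The argument produces \<open>72 = 8 * 3\<^sup>2\<close>, so the value 3 is what
    it really yields for c. The witness 10 gives \<open>800 = 8 * 10\<^sup>2\<close> and merely
    enlarges the event.\<close>
  have "72 * \<eta>\<^sup>2 * \<sigma>\<^sup>2 / a \<le> 800 * \<eta>\<^sup>2 * \<sigma>\<^sup>2 / a"
    using a by (intro divide_right_mono mult_right_mono) auto
  also have "\<dots> = 8 * \<eta> * (absolute_cap * \<sigma>)\<^sup>2 / (\<mu> - \<gamma>)"
    using \<eta> \<gamma>_less by (simp add: a_def absolute_cap_def field_simps power2_eq_square)
  finally have "(72 * \<eta>\<^sup>2 * \<sigma>\<^sup>2 / a + 4 * (\<Delta> / a)\<^sup>2) * ln (exp 1 / \<delta>)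
      \<le> (8 * \<eta> * (absolute_cap * \<sigma>)\<^sup>2 / (\<mu> - \<gamma>) + 4 * (\<Delta> / a)\<^sup>2) * ln (exp 1 / \<delta>)"
  proof (intro mult_right_mono add_right_mono)
    have "ln \<delta> < 0" using \<delta> by simp
    moreover have "ln (exp 1 / \<delta>) = 1 - ln \<delta>" using \<delta> by (simp add: ln_div)
    ultimately show "0 \<le> ln (exp 1 / \<delta>)" by linarith
  qed
  then have sub: "{\<omega> \<in> space M. (norm (x t \<omega> - xbar t \<omega>))\<^sup>2
        \<le> (1 - a / 2) ^ t * (norm (x 0 \<omega> - xbar 0 \<omega>))\<^sup>2
          + (72 * \<eta>\<^sup>2 * \<sigma>\<^sup>2 / a + 4 * (\<Delta> / a)\<^sup>2) * ln (exp 1 / \<delta>)}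
      \<subseteq> {\<omega> \<in> space M. (norm (x t \<omega> - xbar t \<omega>))\<^sup>2
        \<le> (1 - a / 2) ^ t * (norm (x 0 \<omega> - xbar 0 \<omega>))\<^sup>2
          + (8 * \<eta> * (absolute_cap * \<sigma>)\<^sup>2 / (\<mu> - \<gamma>) + 4 * (\<Delta> / a)\<^sup>2) * ln (exp 1 / \<delta>)}"
    by auto
  have [measurable]: "x t \<in> borel_measurable M" "xbar t \<in> borel_measurable M" for t
    by (rule measurable_from_subalg[OF S.subalgebra_F] S.x_measurable S.xbar_measurable)+
  have good_meas: "{\<omega> \<in> space M. (norm (x t \<omega> - xbar t \<omega>))\<^sup>2
      \<le> k * (norm (x 0 \<omega> - xbar 0 \<omega>))\<^sup>2 + k'} \<in> sets M" for k k'
    by measurable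
  have "1 - \<delta> \<le> measure M {\<omega> \<in> space M. (norm (x t \<omega> - xbar t \<omega>))\<^sup>2
        \<le> (1 - a / 2) ^ t * (norm (x 0 \<omega> - xbar 0 \<omega>))\<^sup>2
          + (72 * \<eta>\<^sup>2 * \<sigma>\<^sup>2 / a + 4 * (\<Delta> / a)\<^sup>2) * ln (exp 1 / \<delta>)}"
    by (rule S.tracking_error_high_probability[OF \<sigma> \<Delta> a \<eta>(1) _ _ step(3)]) (use * \<delta> in blast)+
  also have "\<dots> \<le> measure M {\<omega> \<in> space M. (norm (x t \<omega> - xbar t \<omega>))\<^sup>2
        \<le> (1 - a / 2) ^ t * (norm (x 0 \<omega> - xbar 0 \<omega>))\<^sup>2
          + (8 * \<eta> * (absolute_cap * \<sigma>)\<^sup>2 / (\<mu> - \<gamma>) + 4 * (\<Delta> / a)\<^sup>2) * ln (exp 1 / \<delta>)}"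
    by (rule S.finite_measure_mono[OF sub good_meas])
  finally show "1 - \<delta> \<le> measure M {\<omega> \<in> space M.
          (norm (x t \<omega> - xbar t \<omega>))\<^sup>2
            \<le> (1 - (\<mu> - \<gamma>) * \<eta> / 2) ^ t * (norm (x 0 \<omega> - xbar 0 \<omega>))\<^sup>2
              + (8 * \<eta> * (absolute_cap * \<sigma>)\<^sup>2 / (\<mu> - \<gamma>) + 4 * (\<Delta> / ((\<mu> - \<gamma>) * \<eta>))\<^sup>2)
                * ln (exp 1 / \<delta>)}"
    by (simp only: a_def)
qed

end
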